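(* Let $G$ be a profinite group and let $f\colon X\to Y$ be a $G$-equivariant continuous map of profinite $G$-spaces. The pull back functor $f^*$ from $G$-sheaves of sets over $Y$ to $G$-sheaves of sets over $X$ is left adjoint to the push forward functor $f_*$ from $G$-sheaves of sets over $X$ to $G$-sheaves of sets over $Y$.
   Context: A profinite space is a compact, Hausdorff, totally disconnected space; a profinite group is a topological group whose underlying space is profinite. A $G$-space is a space with a continuous left $G$-action. A $G$-sheaf of sets over $X$ is a $G$-equivariant local homeomorphism $p\colon E\to X$ with $E$ a $G$-space; morphisms are continuous $G$-equivariant maps over $X$. Sections over an open set $U$ are all continuous sections $s\colon U\to E$, and $g\in G$ sends $s$ to $g\ast s=g\circ s\circ g^{-1}$, a section over $gU$. For a $G$-sheaf $E$ over $Y$, $f^*E=X\times_YE\to X$ is the pull back, with $G$-action $g(x,e)=(gx,ge)$. For a $G$-sheaf $F$ over $X$, $f_*F$ is the sheaf over $Y$ with sections $(f_*F)(V)=F(f^{-1}V)$ for $V\subseteq Y$ open, with the $G$-action given on sections by $F(f^{-1}V)\to F(gf^{-1}V)=F(f^{-1}(gV))$, $s\mapsto g\ast s$; its sheaf space (with $g(s_y)=(g\ast s)_{gy}$ on germs) is a $G$-sheaf of sets over $Y$. *)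

theory Defs
  imports "HOL-Analysis.Analysis" "HOL-Algebra.Group_Action"
begin

definition profinite_space :: "'a topology \<Rightarrow> bool" where
  "profinite_space T \<longleftrightarrow>
     compact_space T \<and> Hausdorff_space T \<and>
     (\<forall>C. connectedin T C \<longrightarrow> (\<exists>a. C \<subseteq> {a}))"

record 'g top_group = "'g monoid" +
  group_topology :: "'g topology"

definition profinite_group :: "'g top_group \<Rightarrow> bool" where
  "profinite_group G \<longleftrightarrow>
     group G \<and> topspace (group_topology G) = carrier G \<and>
     continuous_map (prod_topology (group_topology G) (group_topology G)) (group_topology G)
       (\<lambda>(g, h). g \<otimes>\<^bsub>G\<^esub> h) \<and>
     continuous_map (group_topology G) (group_topology G) (\<lambda>g. inv\<^bsub>G\<^esub> g) \<and>
     profinite_space (group_topology G)"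


text \<open>
  Spaces live on explicit carriers. As demanded by the library's \<open>group_action\<close>, the
  functions \<open>act g\<close> are extensional, that is, \<open>undefined\<close> outside the carrier.
\<close>

record ('g, 'x) gspace =
  gtop :: "'x topology"
  act :: "'g \<Rightarrow> 'x \<Rightarrow> 'x"

abbreviation pts :: "('g, 'x, 'm) gspace_scheme \<Rightarrow> 'x set" where
  "pts X \<equiv> topspace (gtop X)"

definition is_gspace :: "'g top_group \<Rightarrow> ('g, 'x, 'm) gspace_scheme \<Rightarrow> bool" where
  "is_gspace G X \<longleftrightarrow>
     group_action G (pts X) (act X) \<and>
     continuous_map (prod_topology (group_topology G) (gtop X)) (gtop X) (\<lambda>(g, x). act X g x)"

definition profinite_gspace :: "'g top_group \<Rightarrow> ('g, 'x, 'm) gspace_scheme \<Rightarrow> bool" where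
  "profinite_gspace G X \<longleftrightarrow> is_gspace G X \<and> profinite_space (gtop X)"

definition equivariant_map ::
  "'g top_group \<Rightarrow> ('g, 'x, 'm) gspace_scheme \<Rightarrow> ('g, 'y, 'n) gspace_scheme \<Rightarrow> ('x \<Rightarrow> 'y) \<Rightarrow> bool" where
  "equivariant_map G X Y f \<longleftrightarrow>
     continuous_map (gtop X) (gtop Y) f \<and>
     (\<forall>g\<in>carrier G. \<forall>x\<in>pts X. f (act X g x) = act Y g (f x))"

definition local_homeomorphism :: "'a topology \<Rightarrow> 'b topology \<Rightarrow> ('a \<Rightarrow> 'b) \<Rightarrow> bool" where
  "local_homeomorphism S T p \<longleftrightarrow>
     (\<forall>e\<in>topspace S. \<exists>U. openin S U \<and> e \<in> U \<and> openin T (p ` U) \<and>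
        homeomorphic_map (subtopology S U) (subtopology T (p ` U)) p)"

record ('g, 'e, 'x) gsheaf = "('g, 'e) gspace" +
  sproj :: "'e \<Rightarrow> 'x"

definition is_gsheaf ::
  "'g top_group \<Rightarrow> ('g, 'x) gspace \<Rightarrow> ('g, 'e, 'x) gsheaf \<Rightarrow> bool" where
  "is_gsheaf G X E \<longleftrightarrow>
     is_gspace G E \<and> equivariant_map G E X (sproj E) \<and>
     local_homeomorphism (gtop E) (gtop X) (sproj E)"

text \<open>
  Morphisms are extensional, so that equality of morphisms is equality of functions; they are
  composed with \<open>compose\<close> and the identity of \<open>E\<close> is \<open>\<lambda>e\<in>pts E. e\<close>.
\<close>

definition gsheaf_hom ::
  "'g top_group \<Rightarrow> ('g, 'd, 'x) gsheaf \<Rightarrow> ('g, 'e, 'x) gsheaf \<Rightarrow> ('d \<Rightarrow> 'e) set" where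
  "gsheaf_hom G E E' =
     {h \<in> extensional (pts E). equivariant_map G E E' h \<and>
        (\<forall>e\<in>pts E. sproj E' (h e) = sproj E e)}"

definition sections ::
  "('g, 'x) gspace \<Rightarrow> ('g, 'e, 'x) gsheaf \<Rightarrow> 'x set \<Rightarrow> ('x \<Rightarrow> 'e) set" where
  "sections X E U =
     {s \<in> extensional U. continuous_map (subtopology (gtop X) U) (gtop E) s \<and>
        (\<forall>x\<in>U. sproj E (s x) = x)}"

text \<open>The section \<open>g \<^bold>* s = g \<circ> s \<circ> g\<^sup>-\<^sup>1\<close> over \<open>gU\<close>, for a section \<open>s\<close> over \<open>U\<close>.\<close>

definition translate ::
  "'g top_group \<Rightarrow> ('g, 'x) gspace \<Rightarrow> ('g, 'e, 'x) gsheaf \<Rightarrow> 'g \<Rightarrow> 'x set \<Rightarrow> ('x \<Rightarrow> 'e) \<Rightarrow> 'x \<Rightarrow> 'e" where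
  "translate G X E g U s = (\<lambda>x \<in> act X g ` U. act E g (s (act X (inv\<^bsub>G\<^esub> g) x)))"


subsection \<open>Pull back\<close>

definition pull_space ::
  "('g, 'x) gspace \<Rightarrow> ('x \<Rightarrow> 'y) \<Rightarrow> ('g, 'e, 'y) gsheaf \<Rightarrow> ('x \<times> 'e) topology" where
  "pull_space X f E =
     subtopology (prod_topology (gtop X) (gtop E)) {(x, e). f x = sproj E e}"

definition pull ::
  "('g, 'x) gspace \<Rightarrow> ('x \<Rightarrow> 'y) \<Rightarrow> ('g, 'e, 'y) gsheaf \<Rightarrow> ('g, 'x \<times> 'e, 'x) gsheaf" where
  "pull X f E =
     \<lparr>gtop = pull_space X f E,
      act = (\<lambda>g. \<lambda>(x, e) \<in> topspace (pull_space X f E). (act X g x, act E g e)),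
      sproj = fst\<rparr>"

definition pull_map ::
  "('g, 'x) gspace \<Rightarrow> ('x \<Rightarrow> 'y) \<Rightarrow> ('g, 'd, 'y) gsheaf \<Rightarrow> ('d \<Rightarrow> 'e) \<Rightarrow> 'x \<times> 'd \<Rightarrow> 'x \<times> 'e" where
  "pull_map X f E h = (\<lambda>(x, e) \<in> pts (pull X f E). (x, h e))"


subsection \<open>Push forward\<close>

abbreviation preim :: "('g, 'x) gspace \<Rightarrow> ('x \<Rightarrow> 'y) \<Rightarrow> 'y set \<Rightarrow> 'x set" where
  "preim X f V \<equiv> {x \<in> pts X. f x \<in> V}"

definition push_sections ::
  "('g, 'x) gspace \<Rightarrow> ('x \<Rightarrow> 'y) \<Rightarrow> ('g, 'e, 'x) gsheaf \<Rightarrow> 'y set \<Rightarrow> ('x \<Rightarrow> 'e) set" where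
  "push_sections X f F V = sections X F (preim X f V)"

text \<open>
  The germ at \<open>y\<close> of a section \<open>s\<close> of \<open>f\<^sub>*F\<close> over \<open>V\<close> is the class of all pairs \<open>(V', s')\<close> such
  that \<open>s\<close> and \<open>s'\<close> have the same restriction to some open neighbourhood \<open>W\<close> of \<open>y\<close>.
\<close>

type_synonym ('x, 'y, 'e) germ = "('y set \<times> ('x \<Rightarrow> 'e)) set"

definition germ ::
  "('g, 'x) gspace \<Rightarrow> ('g, 'y) gspace \<Rightarrow> ('x \<Rightarrow> 'y) \<Rightarrow> ('g, 'e, 'x) gsheaf \<Rightarrow>
   'y \<Rightarrow> 'y set \<Rightarrow> ('x \<Rightarrow> 'e) \<Rightarrow> ('x, 'y, 'e) germ" where
  "germ X Y f F y V s =
     {(V', s'). openin (gtop Y) V' \<and> y \<in> V' \<and> s' \<in> push_sections X f F V' \<and>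
        (\<exists>W. openin (gtop Y) W \<and> y \<in> W \<and> W \<subseteq> V \<inter> V' \<and> (\<forall>x\<in>preim X f W. s x = s' x))}"

text \<open>
  A point of the sheaf space of \<open>f\<^sub>*F\<close> is a pair of a point of \<open>Y\<close> and a germ there. The generating
  sets are the images of the sections of \<open>f\<^sub>*F\<close> under \<open>s \<mapsto> (y \<mapsto> s\<^sub>y)\<close>; they form a base, and their
  union, the carrier, consists of all germs.
\<close>

definition push_space ::
  "('g, 'x) gspace \<Rightarrow> ('g, 'y) gspace \<Rightarrow> ('x \<Rightarrow> 'y) \<Rightarrow> ('g, 'e, 'x) gsheaf \<Rightarrow>
   ('y \<times> ('x, 'y, 'e) germ) topology" where
  "push_space X Y f F =
     topology_generated_by
       {(\<lambda>y. (y, germ X Y f F y V s)) ` V | V s. openin (gtop Y) V \<and> s \<in> push_sections X f F V}"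

text \<open>
  Below, the union over the representatives \<open>(V, s)\<close> of a germ is the usual device for a function on
  equivalence classes: all sets in the union coincide.
\<close>

definition push ::
  "'g top_group \<Rightarrow> ('g, 'x) gspace \<Rightarrow> ('g, 'y) gspace \<Rightarrow> ('x \<Rightarrow> 'y) \<Rightarrow> ('g, 'e, 'x) gsheaf \<Rightarrow>
   ('g, 'y \<times> ('x, 'y, 'e) germ, 'y) gsheaf" where
  "push G X Y f F =
     \<lparr>gtop = push_space X Y f F,
      act = (\<lambda>g. \<lambda>(y, \<gamma>) \<in> topspace (push_space X Y f F).
        (act Y g y,
         \<Union>(V, s)\<in>\<gamma>. germ X Y f F (act Y g y) (act Y g ` V) (translate G X F g (preim X f V) s))),
      sproj = fst\<rparr>"

definition push_map ::
  "('g, 'x) gspace \<Rightarrow> ('g, 'y) gspace \<Rightarrow> ('x \<Rightarrow> 'y) \<Rightarrow> ('g, 'd, 'x) gsheaf \<Rightarrow> ('g, 'e, 'x) gsheaf \<Rightarrow>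
   ('d \<Rightarrow> 'e) \<Rightarrow> 'y \<times> ('x, 'y, 'd) germ \<Rightarrow> 'y \<times> ('x, 'y, 'e) germ" where
  "push_map X Y f F F' h =
     (\<lambda>(y, \<gamma>) \<in> topspace (push_space X Y f F).
        (y, \<Union>(V, s)\<in>\<gamma>. germ X Y f F' y V (compose (preim X f V) h s)))"


subsection \<open>Functors and adjunctions between categories of G-sheaves\<close>

text \<open>\<open>Fm E E' h\<close> is the value of the functor on the morphism \<open>h\<close> from \<open>E\<close> to \<open>E'\<close>.\<close>

definition gsheaf_functor ::
  "'g top_group \<Rightarrow> ('g, 'x) gspace \<Rightarrow> ('g, 'y) gspace \<Rightarrow>
   (('g, 'd, 'x) gsheaf \<Rightarrow> ('g, 'e, 'y) gsheaf) \<Rightarrow>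
   (('g, 'd, 'x) gsheaf \<Rightarrow> ('g, 'd, 'x) gsheaf \<Rightarrow> ('d \<Rightarrow> 'd) \<Rightarrow> 'e \<Rightarrow> 'e) \<Rightarrow> bool" where
  "gsheaf_functor G X Y Fo Fm \<longleftrightarrow>
     (\<forall>E. is_gsheaf G X E \<longrightarrow> is_gsheaf G Y (Fo E)) \<and>
     (\<forall>E E'. is_gsheaf G X E \<longrightarrow> is_gsheaf G X E' \<longrightarrow>
        (\<forall>h\<in>gsheaf_hom G E E'. Fm E E' h \<in> gsheaf_hom G (Fo E) (Fo E'))) \<and>
     (\<forall>E. is_gsheaf G X E \<longrightarrow> Fm E E (\<lambda>e\<in>pts E. e) = (\<lambda>e\<in>pts (Fo E). e)) \<and>
     (\<forall>E E' E''. is_gsheaf G X E \<longrightarrow> is_gsheaf G X E' \<longrightarrow> is_gsheaf G X E'' \<longrightarrow>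
        (\<forall>h\<in>gsheaf_hom G E E'. \<forall>k\<in>gsheaf_hom G E' E''.
           Fm E E'' (compose (pts E) k h) = compose (pts (Fo E)) (Fm E' E'' k) (Fm E E' h)))"

text \<open>
  The functor \<open>(Lo, Lm)\<close> from G-sheaves over \<open>Y\<close> to G-sheaves over \<open>X\<close> is left adjoint to the functor
  \<open>(Ro, Rm)\<close>: there is a bijection \<open>\<phi> E F : Hom (Lo E) F \<rightarrow> Hom E (Ro F)\<close>, natural in \<open>E\<close> and \<open>F\<close>.
  The carriers of \<open>E\<close>, \<open>F\<close>, \<open>Lo E\<close> and \<open>Ro F\<close> are subsets of four independent types.
\<close>

definition gsheaf_left_adjoint ::
  "'g top_group \<Rightarrow> ('g, 'x) gspace \<Rightarrow> ('g, 'y) gspace \<Rightarrow>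
   (('g, 'd, 'y) gsheaf \<Rightarrow> ('g, 'a, 'x) gsheaf) \<Rightarrow>
   (('g, 'd, 'y) gsheaf \<Rightarrow> ('g, 'd, 'y) gsheaf \<Rightarrow> ('d \<Rightarrow> 'd) \<Rightarrow> 'a \<Rightarrow> 'a) \<Rightarrow>
   (('g, 'e, 'x) gsheaf \<Rightarrow> ('g, 'b, 'y) gsheaf) \<Rightarrow>
   (('g, 'e, 'x) gsheaf \<Rightarrow> ('g, 'e, 'x) gsheaf \<Rightarrow> ('e \<Rightarrow> 'e) \<Rightarrow> 'b \<Rightarrow> 'b) \<Rightarrow> bool" where
  "gsheaf_left_adjoint G X Y Lo Lm Ro Rm \<longleftrightarrow>
     gsheaf_functor G Y X Lo Lm \<and> gsheaf_functor G X Y Ro Rm \<and>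
     (\<exists>\<phi>.
       (\<forall>E F. is_gsheaf G Y E \<longrightarrow> is_gsheaf G X F \<longrightarrow>
          bij_betw (\<phi> E F) (gsheaf_hom G (Lo E) F) (gsheaf_hom G E (Ro F))) \<and>
       (\<forall>E E' F. is_gsheaf G Y E \<longrightarrow> is_gsheaf G Y E' \<longrightarrow> is_gsheaf G X F \<longrightarrow>
          (\<forall>h\<in>gsheaf_hom G (Lo E) F. \<forall>u\<in>gsheaf_hom G E' E.
             \<phi> E' F (compose (pts (Lo E')) h (Lm E' E u)) = compose (pts E') (\<phi> E F h) u)) \<and>
       (\<forall>E F F'. is_gsheaf G Y E \<longrightarrow> is_gsheaf G X F \<longrightarrow> is_gsheaf G X F' \<longrightarrow>
          (\<forall>h\<in>gsheaf_hom G (Lo E) F. \<forall>v\<in>gsheaf_hom G F F'.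
             \<phi> E F' (compose (pts (Lo E)) v h) = compose (pts E) (Rm F F' v) (\<phi> E F h))))"

end

theory Submission
  imports Defs
begin

text \<open>
  A morphism \<open>h : f\<^sup>*E \<rightarrow> F\<close> corresponds to the morphism \<open>E \<rightarrow> f\<^sub>*F\<close> sending \<open>e\<close> over \<open>y\<close> to the germ at
  \<open>y\<close> of \<open>x \<mapsto> h (x, \<sigma> (f x))\<close>, where \<open>\<sigma>\<close> is any local section of \<open>E\<close> through \<open>e\<close>; in the other
  direction, \<open>k : E \<rightarrow> f\<^sub>*F\<close> gives \<open>(x, e) \<mapsto> s x\<close>, where \<open>s\<close> represents the germ \<open>k e\<close>. The only point
  that needs compactness is that \<open>G\<close> acts continuously on the sheaf space of \<open>f\<^sub>*F\<close>: two maps into a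
  local homeomorphism with the same projection agree on an open set, so \<open>g s(x) = t(g x)\<close> is an
  open condition on \<open>(g, x)\<close>, and as \<open>f\<close> is proper it holds on a tube around a fibre of \<open>f\<close> as soon as
  it holds on the fibre.
\<close>

section \<open>Local homeomorphisms and proper maps\<close>

text \<open>A single \<open>g\<close> acts on the sheaf space of the push forward by a homeomorphism
  for formal reasons; the obstacle is continuity in \<open>g\<close> and the germ together. A basic
  neighbourhood of a germ fixes one section \<open>t\<close>, while the translates of a section
  \<open>s\<close> form a whole family, and a point of the sheaf space remembers \<open>t\<close>
  along an entire fibre of \<open>f\<close>, not at a single point. So one equality of germs, at one
  group element, must yield equalities for all nearby group elements, uniformly along fibres; this
  uniformity is where properness acts. The other verifications are local on sections: a map out of a
  sheaf space is continuous once it is continuous along sections through every point, and a map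
  defined by choosing a representative or a local section is computed by showing that the choice is
  immaterial.\<close>

lemma continuous_map_locally:
  assumes "\<And>x. x \<in> topspace S \<Longrightarrow> \<exists>N. openin S N \<and> x \<in> N \<and> continuous_map (subtopology S N) T h"
  shows "continuous_map S T h"
proof -
  let ?I = "{N. openin S N \<and> continuous_map (subtopology S N) T h}"
  show ?thesis
    by (rule pasting_lemma[where I = ?I and T = id and f = "\<lambda>_. h"]) (use assms in auto)
qed

text \<open>The inverse of \<open>p\<close> on a small open set, regarded as a map into all of
  \<open>S\<close>. The equation \<open>\<sigma> (p u) = u\<close> also records that
  \<open>p\<close> is injective on \<open>U\<close>, which is how it is used below.\<close>

lemma local_homeomorphism_section:
  assumes "local_homeomorphism S T p" "e \<in> topspace S"
  obtains U \<sigma> where "openin S U" "e \<in> U" "openin T (p ` U)"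
    "continuous_map (subtopology T (p ` U)) S \<sigma>" "\<And>u. u \<in> U \<Longrightarrow> \<sigma> (p u) = u"
proof -
  obtain U where U: "openin S U" "e \<in> U" "openin T (p ` U)"
    and h: "homeomorphic_map (subtopology S U) (subtopology T (p ` U)) p"
    using assms unfolding local_homeomorphism_def by blast
  obtain \<sigma> where "homeomorphic_maps (subtopology S U) (subtopology T (p ` U)) p \<sigma>"
    using h homeomorphic_map_maps by blast
  moreover have "U \<subseteq> topspace S" using U openin_subset by blast
  ultimately show thesis
    using that[of U \<sigma>] U continuous_map_into_fulltopology
    unfolding homeomorphic_maps_def by (metis topspace_subtopology_subset)
qed

text \<open>A continuous left inverse on the image is enough: every point of the image has the form
  \<open>p u\<close>, so the left inverse is a right inverse as well.\<close>

lemma local_homeomorphismI: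
  assumes p: "continuous_map S T p"
    and loc: "\<And>e. e \<in> topspace S \<Longrightarrow> \<exists>U \<sigma>. openin S U \<and> e \<in> U \<and> openin T (p ` U) \<and>
      continuous_map (subtopology T (p ` U)) S \<sigma> \<and> (\<forall>u\<in>U. \<sigma> (p u) = u)"
  shows "local_homeomorphism S T p"
  unfolding local_homeomorphism_def
proof
  fix e assume "e \<in> topspace S"
  then obtain U \<sigma> where U: "openin S U" "e \<in> U" "openin T (p ` U)"
    and \<sigma>: "continuous_map (subtopology T (p ` U)) S \<sigma>" "\<forall>u\<in>U. \<sigma> (p u) = u"
    using loc by blast
  have "homeomorphic_maps (subtopology S U) (subtopology T (p ` U)) p \<sigma>"
    unfolding homeomorphic_maps_def continuous_map_in_subtopology
    using p \<sigma> by (auto intro: continuous_map_from_subtopology)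
  then show "\<exists>U. openin S U \<and> e \<in> U \<and> openin T (p ` U) \<and>
      homeomorphic_map (subtopology S U) (subtopology T (p ` U)) p"
    using U homeomorphic_map_maps by blast
qed

text \<open>At a point of agreement choose an open set on which \<open>p\<close> is injective. Both
  maps take values in it nearby, and equal projections then force equal values. This turns agreement
  at one point into agreement on a neighbourhood, both in \<open>x\<close> and in
  \<open>(g, x)\<close>.\<close>

lemma openin_local_homeomorphism_equalizer:
  assumes p: "local_homeomorphism S T p"
    and a: "continuous_map Z S a" and b: "continuous_map Z S b"
    and pab: "\<And>z. z \<in> topspace Z \<Longrightarrow> p (a z) = p (b z)"
  shows "openin Z {z \<in> topspace Z. a z = b z}"
proof (subst openin_subopen, safe)
  fix z assume z: "z \<in> topspace Z" "a z = b z"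
  then have "a z \<in> topspace S" using continuous_map_image_subset_topspace[OF a] by blast
  then obtain U \<sigma> where U: "openin S U" "a z \<in> U" and \<sigma>: "\<And>u. u \<in> U \<Longrightarrow> \<sigma> (p u) = u"
    using local_homeomorphism_section[OF p] by metis
  let ?W = "{z \<in> topspace Z. a z \<in> U} \<inter> {z \<in> topspace Z. b z \<in> U}"
  have "openin Z ?W" using a b U by (intro openin_Int openin_continuous_map_preimage)
  moreover have "z \<in> ?W" using z U by auto
  moreover have "?W \<subseteq> {z \<in> topspace Z. a z = b z}"
    using \<sigma> pab by (smt (verit) IntE mem_Collect_eq subsetI)
  ultimately show "\<exists>W. openin Z W \<and> z \<in> W \<and> W \<subseteq> {z \<in> topspace Z. a z = b z}" by blast
qed

text \<open>A tube lemma relative to \<open>f\<close>: proper maps are stable under products, so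
  \<open>id\<close> times \<open>f\<close> is closed, and it sends the complement of
  \<open>U\<close> to a closed set missing \<open>(t, y)\<close>. With \<open>Y\<close> a point this
  is the classical tube lemma. The fibre over \<open>y\<close> may be empty.\<close>

lemma proper_map_tube:
  assumes f: "proper_map X Y f" and U: "openin (prod_topology T X) U"
    and t: "t \<in> topspace T" and y: "y \<in> topspace Y"
    and fib: "\<And>x. x \<in> topspace X \<Longrightarrow> f x = y \<Longrightarrow> (t, x) \<in> U"
  obtains N V where "openin T N" "t \<in> N" "openin Y V" "y \<in> V"
    "\<forall>s\<in>N. \<forall>x\<in>topspace X. f x \<in> V \<longrightarrow> (s, x) \<in> U"
proof -
  let ?C = "(\<lambda>(s, x). (id s, f x)) ` (topspace (prod_topology T X) - U)"
  have "proper_map (prod_topology T X) (prod_topology T Y) (\<lambda>(s, x). (id s, f x))"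
    using f by (subst proper_map_prod) auto
  then have "closed_map (prod_topology T X) (prod_topology T Y) (\<lambda>(s, x). (id s, f x))"
    by (rule proper_imp_closed_map)
  then have "closedin (prod_topology T Y) ?C"
    using U by (simp add: closed_map_def openin_closedin_eq)
  then have "openin (prod_topology T Y) (topspace (prod_topology T Y) - ?C)" by blast
  moreover have "(t, y) \<in> topspace (prod_topology T Y) - ?C" using t y fib by auto
  ultimately obtain N V where NV: "openin T N" "openin Y V" "t \<in> N" "y \<in> V"
    and sub: "N \<times> V \<subseteq> topspace (prod_topology T Y) - ?C"
    unfolding openin_prod_topology_alt by meson
  show thesis
  proof
    show "\<forall>s\<in>N. \<forall>x\<in>topspace X. f x \<in> V \<longrightarrow> (s, x) \<in> U"
    proof (intro ballI impI, rule ccontr)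
      fix s x assume s: "s \<in> N" and x: "x \<in> topspace X" "f x \<in> V" and "(s, x) \<notin> U"
      moreover have "s \<in> topspace T" using s NV openin_subset by blast
      ultimately have "(s, f x) \<in> ?C" by force
      then show False using s x sub by blast
    qed
  qed (use NV in auto)
qed

section \<open>G-spaces\<close>

text \<open>The library asks for a homomorphism into the group of extensional permutations.
  Bijectivity of \<open>act X g\<close> comes for free, with inverse the action of the inverse of
  \<open>g\<close>, so only the elementary axioms of an action remain to be checked.\<close>

lemma is_gspaceI:
  assumes G: "group G"
    and closed: "\<And>g x. g \<in> carrier G \<Longrightarrow> x \<in> pts X \<Longrightarrow> act X g x \<in> pts X"
    and one: "\<And>x. x \<in> pts X \<Longrightarrow> act X \<one>\<^bsub>G\<^esub> x = x"
    and mult: "\<And>g h x. g \<in> carrier G \<Longrightarrow> h \<in> carrier G \<Longrightarrow> x \<in> pts X \<Longrightarrow>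
      act X (g \<otimes>\<^bsub>G\<^esub> h) x = act X g (act X h x)"
    and ext: "\<And>g. g \<in> carrier G \<Longrightarrow> act X g \<in> extensional (pts X)"
    and cont: "continuous_map (prod_topology (group_topology G) (gtop X)) (gtop X) (\<lambda>(g, x). act X g x)"
  shows "is_gspace G X"
proof -
  interpret group G by fact
  have bij: "act X g \<in> Bij (pts X)" if g: "g \<in> carrier G" for g
  proof -
    have "bij_betw (act X g) (pts X) (pts X)"
      by (rule bij_betw_byWitness[where f' = "act X (inv\<^bsub>G\<^esub> g)"])
        (use g closed one in \<open>auto simp flip: mult\<close>)
    then show ?thesis using ext g by (simp add: Bij_def)
  qed
  have "act X \<in> hom G (BijGroup (pts X))"
  proof (rule homI)
    fix g h assume gh: "g \<in> carrier G" "h \<in> carrier G"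
    have "act X (g \<otimes>\<^bsub>G\<^esub> h) = compose (pts X) (act X g) (act X h)"
      by (rule extensionalityI[of _ "pts X"]) (use gh ext mult in \<open>auto simp: compose_eq\<close>)
    then show "act X (g \<otimes>\<^bsub>G\<^esub> h) = act X g \<otimes>\<^bsub>BijGroup (pts X)\<^esub> act X h"
      using bij gh by (simp add: BijGroup_def)
  qed (use bij in \<open>simp add: BijGroup_def\<close>)
  then show ?thesis
    using G group_BijGroup cont
    by (simp add: is_gspace_def group_action_def group_hom_def group_hom_axioms_def)
qed

lemma
  assumes X: "is_gspace G X"
  shows gspace_group: "group G"
    and gspace_act_closed: "g \<in> carrier G \<Longrightarrow> x \<in> pts X \<Longrightarrow> act X g x \<in> pts X"
    and gspace_act_one: "x \<in> pts X \<Longrightarrow> act X \<one>\<^bsub>G\<^esub> x = x"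
    and gspace_act_mult: "g \<in> carrier G \<Longrightarrow> h \<in> carrier G \<Longrightarrow> x \<in> pts X \<Longrightarrow>
      act X (g \<otimes>\<^bsub>G\<^esub> h) x = act X g (act X h x)"
    and gspace_act_continuous:
      "continuous_map (prod_topology (group_topology G) (gtop X)) (gtop X) (\<lambda>(g, x). act X g x)"
proof -
  interpret group_action G "pts X" "act X" using X by (simp add: is_gspace_def)
  show "group G" using group_hom group_hom.axioms(1) by auto
  show "g \<in> carrier G \<Longrightarrow> x \<in> pts X \<Longrightarrow> act X g x \<in> pts X" by (rule element_image) auto
  show "x \<in> pts X \<Longrightarrow> act X \<one>\<^bsub>G\<^esub> x = x" using id_eq_one by (metis restrict_apply')
  show "g \<in> carrier G \<Longrightarrow> h \<in> carrier G \<Longrightarrow> x \<in> pts X \<Longrightarrow>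
      act X (g \<otimes>\<^bsub>G\<^esub> h) x = act X g (act X h x)" by (rule composition_rule)
  show "continuous_map (prod_topology (group_topology G) (gtop X)) (gtop X) (\<lambda>(g, x). act X g x)"
    using X by (simp add: is_gspace_def)
qed

lemma
  assumes X: "is_gspace G X" and g: "g \<in> carrier G" and x: "x \<in> pts X"
  shows gspace_act_inv_act: "act X (inv\<^bsub>G\<^esub> g) (act X g x) = x"
    and gspace_act_act_inv: "act X g (act X (inv\<^bsub>G\<^esub> g) x) = x"
proof -
  interpret group G using X by (rule gspace_group)
  show "act X (inv\<^bsub>G\<^esub> g) (act X g x) = x" "act X g (act X (inv\<^bsub>G\<^esub> g) x) = x"
    using X g x by (simp_all add: gspace_act_one flip: gspace_act_mult)
qed

text \<open>Translates \<open>gU\<close> become preimages under the inverse of \<open>g\<close>;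
  openness of \<open>gU\<close> and continuity of translated sections are read off from
  this.\<close>

lemma act_image_iff:
  assumes X: "is_gspace G X" and g: "g \<in> carrier G" and U: "U \<subseteq> pts X"
  shows "x \<in> act X g ` U \<longleftrightarrow> x \<in> pts X \<and> act X (inv\<^bsub>G\<^esub> g) x \<in> U"
proof -
  interpret group G using X by (rule gspace_group)
  have "x \<in> pts X" "act X (inv\<^bsub>G\<^esub> g) x \<in> U" if "x \<in> act X g ` U"
    using that U gspace_act_closed[OF X g] gspace_act_inv_act[OF X g] by auto
  moreover have "x \<in> act X g ` U" if "x \<in> pts X" "act X (inv\<^bsub>G\<^esub> g) x \<in> U"
    using that gspace_act_act_inv[OF X g] by (metis image_eqI)
  ultimately show ?thesis by blast
qed

lemma continuous_map_act:
  assumes X: "is_gspace G X" and top: "topspace (group_topology G) = carrier G" and g: "g \<in> carrier G"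
  shows "continuous_map (gtop X) (gtop X) (act X g)"
proof -
  have "continuous_map (gtop X) (prod_topology (group_topology G) (gtop X)) (\<lambda>x. (g, x))"
    using g top by (intro continuous_intros) (auto simp: continuous_map_const)
  from continuous_map_compose[OF this gspace_act_continuous[OF X]] show ?thesis
    by (simp add: o_def)
qed

lemma openin_act_image:
  assumes X: "is_gspace G X" and top: "topspace (group_topology G) = carrier G"
    and g: "g \<in> carrier G" and U: "openin (gtop X) U"
  shows "openin (gtop X) (act X g ` U)"
proof -
  interpret group G using X by (rule gspace_group)
  have "act X g ` U = {x \<in> pts X. act X (inv\<^bsub>G\<^esub> g) x \<in> U}"
    using act_image_iff[OF X g openin_subset[OF U]] by blast
  then show ?thesis
    using openin_continuous_map_preimage[OF continuous_map_act[OF X top] U] g by simp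
qed

section \<open>G-sheaves and their sections\<close>

lemma
  assumes E: "is_gsheaf G X E"
  shows gsheaf_gspace: "is_gspace G E"
    and gsheaf_sproj_continuous: "continuous_map (gtop E) (gtop X) (sproj E)"
    and gsheaf_sproj_act: "g \<in> carrier G \<Longrightarrow> e \<in> pts E \<Longrightarrow> sproj E (act E g e) = act X g (sproj E e)"
    and gsheaf_sproj_local_homeomorphism: "local_homeomorphism (gtop E) (gtop X) (sproj E)"
  using E continuous_map_image_subset_topspace
  by (fastforce simp: is_gsheaf_def equivariant_map_def)+

lemma
  assumes h: "h \<in> gsheaf_hom G E E'"
  shows gsheaf_hom_extensional: "h \<in> extensional (pts E)"
    and gsheaf_hom_continuous: "continuous_map (gtop E) (gtop E') h"
    and gsheaf_hom_act: "g \<in> carrier G \<Longrightarrow> e \<in> pts E \<Longrightarrow> h (act E g e) = act E' g (h e)"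
    and gsheaf_hom_sproj: "e \<in> pts E \<Longrightarrow> sproj E' (h e) = sproj E e"
    and gsheaf_hom_closed: "e \<in> pts E \<Longrightarrow> h e \<in> pts E'"
  using h continuous_map_image_subset_topspace
  by (fastforce simp: gsheaf_hom_def equivariant_map_def)+

lemma gsheaf_homI:
  assumes "h \<in> extensional (pts E)" "continuous_map (gtop E) (gtop E') h"
    "\<And>g e. g \<in> carrier G \<Longrightarrow> e \<in> pts E \<Longrightarrow> h (act E g e) = act E' g (h e)"
    "\<And>e. e \<in> pts E \<Longrightarrow> sproj E' (h e) = sproj E e"
  shows "h \<in> gsheaf_hom G E E'"
  using assms by (auto simp: gsheaf_hom_def equivariant_map_def)

lemma gsheaf_hom_compose:
  assumes E: "is_gspace G E" and h: "h \<in> gsheaf_hom G E E'" and k: "k \<in> gsheaf_hom G E' E''"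
  shows "compose (pts E) k h \<in> gsheaf_hom G E E''"
proof (rule gsheaf_homI)
  show "continuous_map (gtop E) (gtop E'') (compose (pts E) k h)"
    by (rule continuous_map_eq[OF continuous_map_compose[OF gsheaf_hom_continuous[OF h] gsheaf_hom_continuous[OF k]]])
      (simp add: compose_eq)
qed (use h k E in \<open>simp_all add: compose_eq gsheaf_hom_act gsheaf_hom_sproj gsheaf_hom_closed
    gspace_act_closed compose_extensional\<close>)

lemma
  assumes s: "s \<in> sections X E U"
  shows sections_extensional: "s \<in> extensional U"
    and sections_continuous: "continuous_map (subtopology (gtop X) U) (gtop E) s"
    and sections_sproj: "x \<in> U \<Longrightarrow> sproj E (s x) = x"
    and sections_closed: "U \<subseteq> pts X \<Longrightarrow> x \<in> U \<Longrightarrow> s x \<in> pts E"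
  using s continuous_map_image_subset_topspace[of "subtopology (gtop X) U" "gtop E" s]
  by (auto simp: sections_def image_subset_iff)

lemma sectionsI:
  assumes "s \<in> extensional U" "continuous_map (subtopology (gtop X) U) (gtop E) s"
    "\<And>x. x \<in> U \<Longrightarrow> sproj E (s x) = x"
  shows "s \<in> sections X E U"
  using assms by (simp add: sections_def)

lemma restrict_sections:
  assumes "s \<in> sections X E U" "U' \<subseteq> U"
  shows "restrict s U' \<in> sections X E U'"
proof (rule sectionsI)
  show "continuous_map (subtopology (gtop X) U') (gtop E) (restrict s U')"
    by (rule continuous_map_eq[OF continuous_map_from_subtopology_mono[OF sections_continuous]])
      (use assms in auto)
qed (use sections_sproj[OF assms(1)] assms(2) in auto)

lemma compose_sections:
  assumes h: "h \<in> gsheaf_hom G E E'" and s: "s \<in> sections X E U" and U: "U \<subseteq> pts X"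
  shows "compose U h s \<in> sections X E' U"
proof (rule sectionsI)
  show "continuous_map (subtopology (gtop X) U) (gtop E') (compose U h s)"
    by (rule continuous_map_eq[OF continuous_map_compose[OF sections_continuous[OF s] gsheaf_hom_continuous[OF h]]])
      (simp add: compose_eq)
qed (use h s U in \<open>simp_all add: compose_eq gsheaf_hom_sproj sections_closed sections_sproj\<close>)

lemma translate_sections:
  assumes X: "is_gspace G X" and E: "is_gsheaf G X E"
    and top: "topspace (group_topology G) = carrier G" and g: "g \<in> carrier G"
    and s: "s \<in> sections X E U" and U: "U \<subseteq> pts X"
  shows "translate G X E g U s \<in> sections X E (act X g ` U)"
proof -
  interpret group G using X by (rule gspace_group)
  note iff = act_image_iff[OF X g U]
  show ?thesis
  proof (rule sectionsI)
    have "continuous_map (subtopology (gtop X) (act X g ` U)) (subtopology (gtop X) U) (act X (inv\<^bsub>G\<^esub> g))"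
      unfolding continuous_map_in_subtopology
      using continuous_map_act[OF X top, of "inv\<^bsub>G\<^esub> g"] g iff
      by (auto intro: continuous_map_from_subtopology)
    then have "continuous_map (subtopology (gtop X) (act X g ` U)) (gtop E) (act E g \<circ> (s \<circ> act X (inv\<^bsub>G\<^esub> g)))"
      by (intro continuous_map_compose[OF continuous_map_compose[OF _ sections_continuous[OF s]]]
          continuous_map_act[OF gsheaf_gspace[OF E] top g])
    then show "continuous_map (subtopology (gtop X) (act X g ` U)) (gtop E) (translate G X E g U s)"
      by (rule continuous_map_eq) (simp add: translate_def)
  next
    fix x assume "x \<in> act X g ` U"
    then have "x \<in> pts X" "act X (inv\<^bsub>G\<^esub> g) x \<in> U" using iff by blast+
    then show "sproj E (translate G X E g U s x) = x"
      using \<open>x \<in> act X g ` U\<close> s E U g X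
      by (simp add: translate_def gsheaf_sproj_act sections_closed sections_sproj gspace_act_act_inv)
  qed (simp add: translate_def)
qed

text \<open>Writing a point of \<open>gU\<close> as \<open>gx\<close> removes the inverse from the
  definition. Translated sections are evaluated in this form throughout.\<close>

lemma translate_act:
  assumes X: "is_gspace G X" and g: "g \<in> carrier G" and "U \<subseteq> pts X" "x \<in> U"
  shows "translate G X E g U s (act X g x) = act E g (s x)"
  using assms by (auto simp: translate_def gspace_act_inv_act subset_iff)

lemma gsheaf_section_through:
  assumes E: "is_gsheaf G X E" and e: "e \<in> pts E"
  obtains U s where "openin (gtop X) U" "s \<in> sections X E U" "sproj E e \<in> U" "s (sproj E e) = e"
proof -
  obtain V \<sigma> where V: "openin (gtop E) V" "e \<in> V" "openin (gtop X) (sproj E ` V)"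
    and cont: "continuous_map (subtopology (gtop X) (sproj E ` V)) (gtop E) \<sigma>"
    and \<sigma>: "\<And>u. u \<in> V \<Longrightarrow> \<sigma> (sproj E u) = u"
    using local_homeomorphism_section[OF gsheaf_sproj_local_homeomorphism[OF E] e] by metis
  have "restrict \<sigma> (sproj E ` V) \<in> sections X E (sproj E ` V)"
    by (rule sectionsI) (use cont \<sigma> in \<open>auto intro: continuous_map_eq\<close>)
  then show thesis using that[OF V(3)] V \<sigma> by simp
qed

text \<open>Sections have equal projections, so the equalizer over the common domain is open. Hence
  the germ of a section of a sheaf space is determined by its value at the point.\<close>

lemma sections_agree_nearby:
  assumes E: "is_gsheaf G X E" and s: "s \<in> sections X E U" and t: "t \<in> sections X E V"
    and U: "openin (gtop X) U" and V: "openin (gtop X) V" and x: "x \<in> U" "x \<in> V" "s x = t x"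
  obtains W where "openin (gtop X) W" "x \<in> W" "W \<subseteq> U \<inter> V" "\<forall>w\<in>W. s w = t w"
proof -
  let ?Z = "subtopology (gtop X) (U \<inter> V)"
  have UV: "openin (gtop X) (U \<inter> V)" using U V by blast
  have top: "topspace ?Z = U \<inter> V" using openin_subset[OF UV] by auto
  have "openin ?Z {z \<in> topspace ?Z. s z = t z}"
  proof (rule openin_local_homeomorphism_equalizer[OF gsheaf_sproj_local_homeomorphism[OF E]])
    show "continuous_map ?Z (gtop E) s" "continuous_map ?Z (gtop E) t"
      using s t by (auto intro: continuous_map_from_subtopology_mono[OF sections_continuous])
  qed (use top s t in \<open>auto simp: sections_sproj\<close>)
  then have "openin (gtop X) {z \<in> U \<inter> V. s z = t z}" using openin_trans_full UV top by metis
  then show thesis using that[of "{z \<in> U \<inter> V. s z = t z}"] x by blast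
qed

text \<open>A section through \<open>e\<close> has an open image, and on that image \<open>h\<close>
  equals \<open>h \<circ> s\<close> after \<open>sproj E\<close>. Continuity of a map out of a sheaf
  space can therefore be tested along one section through each point, where the map is usually
  explicit.\<close>

lemma continuous_map_if_on_sections:
  assumes E: "is_gsheaf G X E"
    and sec: "\<And>e. e \<in> pts E \<Longrightarrow> \<exists>U s. openin (gtop X) U \<and> s \<in> sections X E U \<and>
      sproj E e \<in> U \<and> s (sproj E e) = e \<and> continuous_map (subtopology (gtop X) U) T (h \<circ> s)"
  shows "continuous_map (gtop E) T h"
proof (rule continuous_map_locally)
  fix e assume e: "e \<in> pts E"
  then obtain U s where U: "openin (gtop X) U" and s: "s \<in> sections X E U"
    and se: "sproj E e \<in> U" "s (sproj E e) = e"
    and hs: "continuous_map (subtopology (gtop X) U) T (h \<circ> s)"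
    using sec by meson
  let ?P = "{u \<in> pts E. sproj E u \<in> U}"
  have P: "openin (gtop E) ?P"
    using gsheaf_sproj_continuous[OF E] U by (rule openin_continuous_map_preimage)
  let ?Z = "subtopology (gtop E) ?P"
  have top: "topspace ?Z = ?P" by auto
  have pP: "continuous_map ?Z (subtopology (gtop X) U) (sproj E)"
    unfolding continuous_map_in_subtopology
    using gsheaf_sproj_continuous[OF E] by (auto intro: continuous_map_from_subtopology)
  have sp: "continuous_map ?Z (gtop E) (s \<circ> sproj E)"
    using pP sections_continuous[OF s] by (rule continuous_map_compose)
  \<comment> \<open>\<open>?N\<close> is the image of \<open>s\<close>: the points over
    \<open>U\<close> that \<open>s\<close> recovers from their projection. It is the equalizer of
    \<open>s \<circ> sproj E\<close> and the identity, hence open.\<close>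
  let ?N = "{z \<in> topspace ?Z. (s \<circ> sproj E) z = id z}"
  have "openin ?Z ?N"
  proof (rule openin_local_homeomorphism_equalizer[OF gsheaf_sproj_local_homeomorphism[OF E] sp])
    show "continuous_map ?Z (gtop E) id" by (simp add: continuous_map_from_subtopology)
  qed (use s in \<open>auto simp: sections_sproj\<close>)
  then have N: "openin (gtop E) ?N" using P by (rule openin_trans_full)
  have "continuous_map (subtopology (gtop E) ?N) T ((h \<circ> s) \<circ> sproj E)"
    by (rule continuous_map_from_subtopology_mono[OF continuous_map_compose[OF pP hs]]) auto
  then have "continuous_map (subtopology (gtop E) ?N) T h"
    by (rule continuous_map_eq) auto
  moreover have "e \<in> ?N" using e se by auto
  ultimately show "\<exists>N. openin (gtop E) N \<and> e \<in> N \<and> continuous_map (subtopology (gtop E) N) T h"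
    using N by blast
qed

section \<open>Pull back\<close>

lemma pts_pull: "pts (pull X f E) = {(x, e). x \<in> pts X \<and> e \<in> pts E \<and> f x = sproj E e}"
  by (auto simp: pull_def pull_space_def)

lemma act_pull:
  "act (pull X f E) g = (\<lambda>(x, e) \<in> pts (pull X f E). (act X g x, act E g e))"
  by (simp add: pull_def)

lemma sproj_pull [simp]: "sproj (pull X f E) = fst"
  by (simp add: pull_def)

lemma gtop_pull: "gtop (pull X f E) = subtopology (prod_topology (gtop X) (gtop E)) {(x, e). f x = sproj E e}"
  by (simp add: pull_def pull_space_def)

lemma
  shows continuous_map_pull_fst: "continuous_map (gtop (pull X f E)) (gtop X) fst"
    and continuous_map_pull_snd: "continuous_map (gtop (pull X f E)) (gtop E) snd"
  by (auto simp: gtop_pull intro: continuous_map_from_subtopology continuous_map_fst continuous_map_snd)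

text \<open>The universal property of the fibre product, stated for an arbitrary map
  \<open>h\<close> so that it can be unfolded inside continuity goals.\<close>

lemma continuous_map_into_pull:
  "continuous_map Z (gtop (pull X f E)) h \<longleftrightarrow>
     continuous_map Z (gtop X) (fst \<circ> h) \<and> continuous_map Z (gtop E) (snd \<circ> h) \<and>
     (\<forall>z\<in>topspace Z. f (fst (h z)) = sproj E (snd (h z)))"
  by (auto simp: gtop_pull continuous_map_in_subtopology continuous_map_pairwise split_beta Pi_iff)

text \<open>Compactness is packaged as properness of \<open>f\<close>, the form in which the tube
  argument consumes it.\<close>

locale proper_equivariant_map =
  fixes G :: "'g top_group" and X :: "('g, 'x) gspace" and Y :: "('g, 'y) gspace" and f :: "'x \<Rightarrow> 'y"
  assumes topspace_group: "topspace (group_topology G) = carrier G"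
    and X: "is_gspace G X" and Y: "is_gspace G Y"
    and equivariant: "equivariant_map G X Y f"
    and proper: "proper_map (gtop X) (gtop Y) f"
begin

lemma f_continuous: "continuous_map (gtop X) (gtop Y) f"
  and f_act: "g \<in> carrier G \<Longrightarrow> x \<in> pts X \<Longrightarrow> f (act X g x) = act Y g (f x)"
  using equivariant by (auto simp: equivariant_map_def)

lemma f_closed: "x \<in> pts X \<Longrightarrow> f x \<in> pts Y"
  using f_continuous continuous_map_image_subset_topspace by blast

lemma openin_preim: "openin (gtop Y) V \<Longrightarrow> openin (gtop X) (preim X f V)"
  using f_continuous by (rule openin_continuous_map_preimage)

text \<open>By this identity the translate of a section over the preimage of \<open>V\<close> is
  again a section of the push forward, namely over \<open>gV\<close>.\<close>

lemma preim_act: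
  assumes g: "g \<in> carrier G" and V: "V \<subseteq> pts Y"
  shows "preim X f (act Y g ` V) = act X g ` preim X f V"
proof (rule Set.set_eqI)
  interpret group G using X by (rule gspace_group)
  fix x
  show "x \<in> preim X f (act Y g ` V) \<longleftrightarrow> x \<in> act X g ` preim X f V"
    using act_image_iff[OF X g, of "preim X f V" x] act_image_iff[OF Y g V, of "f x"]
      f_closed[of x] f_act[of "inv\<^bsub>G\<^esub> g" x] gspace_act_closed[OF X, of "inv\<^bsub>G\<^esub> g" x] g by auto
qed

lemma is_gspace_pull:
  assumes E: "is_gsheaf G Y E"
  shows "is_gspace G (pull X f E)"
proof (rule is_gspaceI)
  show "group G" using X by (rule gspace_group)
  then interpret group G .
  note E' = gsheaf_gspace[OF E]
  show closed: "act (pull X f E) g z \<in> pts (pull X f E)" if "g \<in> carrier G" "z \<in> pts (pull X f E)" for g z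
    using that f_act gspace_act_closed[OF X] gspace_act_closed[OF E'] gsheaf_sproj_act[OF E]
    by (auto simp: act_pull pts_pull)
  show "act (pull X f E) \<one>\<^bsub>G\<^esub> z = z" if "z \<in> pts (pull X f E)" for z
    using that gspace_act_one[OF X] gspace_act_one[OF E'] by (auto simp: act_pull pts_pull)
  show "act (pull X f E) (g \<otimes>\<^bsub>G\<^esub> h) z = act (pull X f E) g (act (pull X f E) h z)"
    if "g \<in> carrier G" "h \<in> carrier G" "z \<in> pts (pull X f E)" for g h z
    using that closed[of h z] gspace_act_mult[OF X] gspace_act_mult[OF E'] by (auto simp: act_pull pts_pull)
  show "act (pull X f E) g \<in> extensional (pts (pull X f E))" for g
    by (simp add: act_pull)
  show "continuous_map (prod_topology (group_topology G) (gtop (pull X f E))) (gtop (pull X f E))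
     (\<lambda>(g, x). act (pull X f E) g x)"
    unfolding continuous_map_into_pull
  proof (intro conjI ballI)
    let ?Z = "prod_topology (group_topology G) (gtop (pull X f E))"
    have 1: "continuous_map ?Z (prod_topology (group_topology G) (gtop X)) (\<lambda>z. (fst z, fst (snd z)))"
      and 2: "continuous_map ?Z (prod_topology (group_topology G) (gtop E)) (\<lambda>z. (fst z, snd (snd z)))"
      using continuous_map_compose[OF continuous_map_snd continuous_map_pull_fst]
        continuous_map_compose[OF continuous_map_snd continuous_map_pull_snd]
      by (auto intro!: continuous_map_pairedI continuous_map_fst simp: o_def)
    show "continuous_map ?Z (gtop X) (fst \<circ> (\<lambda>(g, x). act (pull X f E) g x))"
      by (rule continuous_map_eq[OF continuous_map_compose[OF 1 gspace_act_continuous[OF X]]])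
        (auto simp: act_pull)
    show "continuous_map ?Z (gtop E) (snd \<circ> (\<lambda>(g, x). act (pull X f E) g x))"
      by (rule continuous_map_eq[OF continuous_map_compose[OF 2 gspace_act_continuous[OF E']]])
        (auto simp: act_pull)
    fix z assume "z \<in> topspace ?Z"
    then have "(case z of (g, x) \<Rightarrow> act (pull X f E) g x) \<in> pts (pull X f E)"
      using closed topspace_group by auto
    then show "f (fst (case z of (g, x) \<Rightarrow> act (pull X f E) g x)) =
        sproj E (snd (case z of (g, x) \<Rightarrow> act (pull X f E) g x))"
      by (auto simp: pts_pull)
  qed
qed

text \<open>Pulling back a local section. Such sections pass through every point of the pull back,
  so they provide the local inverses of \<open>fst\<close>; composed with a morphism out of the pull
  back they provide the germs of its transpose.\<close>

lemma pull_section: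
  assumes "\<sigma> \<in> sections Y E V" and V: "openin (gtop Y) V"
  shows "(\<lambda>x \<in> preim X f V. (x, \<sigma> (f x))) \<in> sections X (pull X f E) (preim X f V)"
proof (rule sectionsI)
  let ?Z = "subtopology (gtop X) (preim X f V)"
  have "continuous_map ?Z (subtopology (gtop Y) V) f"
    unfolding continuous_map_in_subtopology
    using f_continuous by (auto intro: continuous_map_from_subtopology)
  from continuous_map_compose[OF this sections_continuous[OF assms(1)]]
  have \<sigma>f: "continuous_map ?Z (gtop E) (\<sigma> \<circ> f)" .
  show "continuous_map ?Z (gtop (pull X f E)) (\<lambda>x \<in> preim X f V. (x, \<sigma> (f x)))"
    unfolding continuous_map_into_pull
  proof (intro conjI ballI)
    show "continuous_map ?Z (gtop X) (fst \<circ> (\<lambda>x \<in> preim X f V. (x, \<sigma> (f x))))"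
      by (rule continuous_map_eq[of _ _ id]) (auto intro: continuous_map_from_subtopology)
    show "continuous_map ?Z (gtop E) (snd \<circ> (\<lambda>x \<in> preim X f V. (x, \<sigma> (f x))))"
      by (rule continuous_map_eq[OF \<sigma>f]) auto
  qed (use sections_sproj[OF assms(1)] in auto)
qed auto

lemma is_gsheaf_pull:
  assumes E: "is_gsheaf G Y E"
  shows "is_gsheaf G X (pull X f E)"
  unfolding is_gsheaf_def
proof (intro conjI)
  show "is_gspace G (pull X f E)" using E by (rule is_gspace_pull)
  show "equivariant_map G (pull X f E) X (sproj (pull X f E))"
    using continuous_map_pull_fst by (auto simp: equivariant_map_def act_pull)
  show "local_homeomorphism (gtop (pull X f E)) (gtop X) (sproj (pull X f E))"
  proof (rule local_homeomorphismI)
    fix z assume z: "z \<in> pts (pull X f E)"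
    then obtain U \<sigma> where U: "openin (gtop E) U" "snd z \<in> U" "openin (gtop Y) (sproj E ` U)"
      and cont: "continuous_map (subtopology (gtop Y) (sproj E ` U)) (gtop E) \<sigma>"
      and \<sigma>: "\<And>u. u \<in> U \<Longrightarrow> \<sigma> (sproj E u) = u"
      using local_homeomorphism_section[OF gsheaf_sproj_local_homeomorphism[OF E], of "snd z"]
      by (metis (mono_tags, lifting) case_prod_unfold mem_Collect_eq pts_pull)
    have \<sigma>_sec: "restrict \<sigma> (sproj E ` U) \<in> sections Y E (sproj E ` U)"
      by (rule sectionsI) (use cont \<sigma> in \<open>auto intro: continuous_map_eq\<close>)
    \<comment> \<open>\<open>?P\<close> is the fibre product of \<open>X\<close> with
      \<open>U\<close>. Since \<open>sproj E\<close> is injective on \<open>U\<close>, it projects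
      bijectively onto \<open>?Q\<close>, with the pulled back section as inverse.\<close>
    let ?P = "{z \<in> pts (pull X f E). snd z \<in> U}" and ?Q = "preim X f (sproj E ` U)"
    have PQ: "fst ` ?P = ?Q"
    proof
      show "fst ` ?P \<subseteq> ?Q" by (auto simp: pts_pull)
      show "?Q \<subseteq> fst ` ?P"
      proof
        fix x assume "x \<in> ?Q"
        then obtain u where "u \<in> U" "f x = sproj E u" "x \<in> pts X" by blast
        then have "(x, u) \<in> ?P" using openin_subset[OF U(1)] by (auto simp: pts_pull)
        then show "x \<in> fst ` ?P" by force
      qed
    qed
    have "openin (gtop (pull X f E)) ?P"
      using continuous_map_pull_snd U(1) by (rule openin_continuous_map_preimage)
    moreover note openin_preim[OF U(3)] sections_continuous[OF pull_section[OF \<sigma>_sec U(3)]]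
    moreover have "\<forall>u\<in>?P. (\<lambda>x \<in> ?Q. (x, restrict \<sigma> (sproj E ` U) (f x))) (fst u) = u"
      using \<sigma> by (auto simp: pts_pull)
    ultimately show "\<exists>U \<sigma>. openin (gtop (pull X f E)) U \<and> z \<in> U \<and> openin (gtop X) (sproj (pull X f E) ` U) \<and>
        continuous_map (subtopology (gtop X) (sproj (pull X f E) ` U)) (gtop (pull X f E)) \<sigma> \<and>
        (\<forall>u\<in>U. \<sigma> (sproj (pull X f E) u) = u)"
      using z U(2) unfolding sproj_pull PQ[symmetric]
      by (intro exI[of _ ?P] exI[of _ "\<lambda>x \<in> fst ` ?P. (x, restrict \<sigma> (sproj E ` U) (f x))"]) auto
  qed (simp add: continuous_map_pull_fst)
qed

lemma pull_map_hom:
  assumes E: "is_gsheaf G Y E" and h: "h \<in> gsheaf_hom G E E'"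
  shows "pull_map X f E h \<in> gsheaf_hom G (pull X f E) (pull X f E')"
proof (rule gsheaf_homI)
  have closed: "(x, h e) \<in> pts (pull X f E')" if "(x, e) \<in> pts (pull X f E)" for x e
    using that h by (auto simp: pts_pull gsheaf_hom_closed gsheaf_hom_sproj)
  show "continuous_map (gtop (pull X f E)) (gtop (pull X f E')) (pull_map X f E h)"
    unfolding continuous_map_into_pull
  proof (intro conjI ballI)
    show "continuous_map (gtop (pull X f E)) (gtop X) (fst \<circ> pull_map X f E h)"
      by (rule continuous_map_eq[OF continuous_map_pull_fst]) (auto simp: pull_map_def)
    show "continuous_map (gtop (pull X f E)) (gtop E') (snd \<circ> pull_map X f E h)"
      by (rule continuous_map_eq[OF continuous_map_compose[OF continuous_map_pull_snd gsheaf_hom_continuous[OF h]]])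
        (auto simp: pull_map_def)
  qed (use closed in \<open>force simp: pull_map_def pts_pull\<close>)
  show "pull_map X f E h (act (pull X f E) g z) = act (pull X f E') g (pull_map X f E h z)"
    if "g \<in> carrier G" "z \<in> pts (pull X f E)" for g z
    using that closed gspace_act_closed[OF is_gspace_pull[OF E] that] gsheaf_hom_act[OF h]
    by (auto simp: pull_map_def act_pull pts_pull)
qed (auto simp: pull_map_def)

lemma gsheaf_functor_pull: "gsheaf_functor G Y X (pull X f) (\<lambda>E E' u. pull_map X f E u)"
  unfolding gsheaf_functor_def
proof (intro conjI allI impI ballI)
  fix E E' E'' :: "('g, 'd, 'y) gsheaf" and h k
  assume E: "is_gsheaf G Y E" and h: "h \<in> gsheaf_hom G E E'"
  show "pull_map X f E (compose (pts E) k h) =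
      compose (pts (pull X f E)) (pull_map X f E' k) (pull_map X f E h)"
    using gsheaf_hom_closed[OF pull_map_hom[OF E h]]
    by (force simp: pull_map_def compose_def pts_pull restrict_def fun_eq_iff)
next
  fix E :: "('g, 'd, 'y) gsheaf"
  show "pull_map X f E (\<lambda>e\<in>pts E. e) = (\<lambda>e\<in>pts (pull X f E). e)"
    by (auto simp: pull_map_def pts_pull restrict_def)
qed (auto intro: is_gsheaf_pull pull_map_hom)

section \<open>Push forward\<close>

definition push_section :: "('g, 'e, 'x) gsheaf \<Rightarrow> 'y set \<Rightarrow> ('x \<Rightarrow> 'e) \<Rightarrow> bool" where
  "push_section F V s \<longleftrightarrow> openin (gtop Y) V \<and> s \<in> push_sections X f F V"

lemma
  assumes "push_section F V s"
  shows push_section_openin: "openin (gtop Y) V"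
    and push_section_subset: "V \<subseteq> pts Y"
    and push_section_sections: "s \<in> sections X F (preim X f V)"
  using assms openin_subset by (auto simp: push_section_def push_sections_def)

lemma push_sectionI:
  "openin (gtop Y) V \<Longrightarrow> s \<in> sections X F (preim X f V) \<Longrightarrow> push_section F V s"
  by (simp add: push_section_def push_sections_def)

lemma push_section_restrict:
  assumes "push_section F V s" "openin (gtop Y) W" "W \<subseteq> V"
  shows "push_section F W (restrict s (preim X f W))"
  by (rule push_sectionI[OF assms(2) restrict_sections[OF push_section_sections[OF assms(1)]]])
    (use assms in auto)

lemma push_section_translate:
  assumes F: "is_gsheaf G X F" and g: "g \<in> carrier G" and s: "push_section F V s"
  shows "push_section F (act Y g ` V) (translate G X F g (preim X f V) s)"
  using translate_sections[OF X F topspace_group g push_section_sections[OF s]]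
    openin_act_image[OF Y topspace_group g push_section_openin[OF s]]
    preim_act[OF g push_section_subset[OF s]]
  by (auto intro: push_sectionI)

lemma push_section_compose:
  assumes h: "h \<in> gsheaf_hom G F F'" and s: "push_section F V s"
  shows "push_section F' V (compose (preim X f V) h s)"
  by (rule push_sectionI[OF push_section_openin[OF s] compose_sections[OF h push_section_sections[OF s]]]) auto

section \<open>Germs of sections of the push forward\<close>

lemma mem_germ:
  assumes s: "push_section F V s" and V: "y \<in> V"
  shows "(V, s) \<in> germ X Y f F y V s"
  using assms by (auto simp: germ_def push_section_def)

lemma germ_eqI:
  fixes F :: "('g, 'e, 'x) gsheaf"
  assumes s: "push_section F V s" and t: "push_section F V' t"
    and W: "openin (gtop Y) W" "y \<in> W" "W \<subseteq> V \<inter> V'" "\<And>x. x \<in> preim X f W \<Longrightarrow> s x = t x"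
  shows "germ X Y f F y V s = germ X Y f F y V' t"
proof -
  \<comment> \<open>One inclusion suffices by symmetry. A neighbourhood witnessing membership in the
    first germ is intersected with \<open>W\<close> to witness membership in the second.\<close>
  have "germ X Y f F y A a \<subseteq> germ X Y f F y B b"
    if "W \<subseteq> B" and "\<And>x. x \<in> preim X f W \<Longrightarrow> a x = b x" for A B and a b :: "'x \<Rightarrow> 'e"
  proof clarify
    fix C c assume "(C, c) \<in> germ X Y f F y A a"
    then obtain W' where W': "openin (gtop Y) W'" "y \<in> W'" "W' \<subseteq> A \<inter> C" "\<forall>x\<in>preim X f W'. a x = c x"
      and C: "openin (gtop Y) C" "y \<in> C" "c \<in> push_sections X f F C"
      by (auto simp: germ_def)
    have "openin (gtop Y) (W \<inter> W')" "y \<in> W \<inter> W'" "W \<inter> W' \<subseteq> B \<inter> C"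
      "\<forall>x\<in>preim X f (W \<inter> W'). b x = c x"
      using W W' that by auto
    then show "(C, c) \<in> germ X Y f F y B b" using C unfolding germ_def by blast
  qed
  from this[of V' s t] this[of V t s] W show ?thesis by (intro subset_antisym) auto
qed

text \<open>A section belongs to its own germ, hence to the equal germ of \<open>s\<close>, and
  membership there already means agreement near \<open>y\<close>.\<close>

lemma germ_eqE:
  assumes eq: "germ X Y f F y V s = germ X Y f F y V' t" and t: "push_section F V' t" and y: "y \<in> V'"
  obtains W where "openin (gtop Y) W" "y \<in> W" "W \<subseteq> V \<inter> V'" "\<forall>x\<in>preim X f W. s x = t x"
proof -
  have "(V', t) \<in> germ X Y f F y V s" using mem_germ[OF t y] eq by simp
  then show thesis using that by (auto simp: germ_def)
qed

lemma germ_memD: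
  assumes "(V', t) \<in> germ X Y f F y V s" and s: "push_section F V s"
  shows "push_section F V' t" "y \<in> V'" "germ X Y f F y V' t = germ X Y f F y V s"
proof -
  show t: "push_section F V' t" and "y \<in> V'" using assms by (auto simp: germ_def push_section_def)
  obtain W where W: "openin (gtop Y) W" "y \<in> W" "W \<subseteq> V \<inter> V'" "\<forall>x\<in>preim X f W. s x = t x"
    using assms(1) by (auto simp: germ_def)
  have "germ X Y f F y V s = germ X Y f F y V' t"
    by (rule germ_eqI[OF s t W(1-3)]) (use W(4) in blast)
  then show "germ X Y f F y V' t = germ X Y f F y V s" ..
qed

lemma germ_restrict:
  assumes s: "push_section F V s" and W: "openin (gtop Y) W" "W \<subseteq> V" "y \<in> W"
  shows "germ X Y f F y W (restrict s (preim X f W)) = germ X Y f F y V s"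
  by (rule germ_eqI[OF push_section_restrict[OF s W(1,2)] s W(1,3)]) (use W in auto)

text \<open>The union of a constant family over a nonempty index set. With \<open>\<Phi>\<close>
  left arbitrary, this reduces both the action on germs and the effect of a morphism on germs to
  independence of the representative.\<close>

lemma UN_germ:
  assumes s: "push_section F V s" and y: "y \<in> V"
    and eq: "\<And>V' t. push_section F V' t \<Longrightarrow> y \<in> V' \<Longrightarrow>
      germ X Y f F y V' t = germ X Y f F y V s \<Longrightarrow> \<Phi> V' t = \<Phi> V s"
  shows "(\<Union>(V, s)\<in>germ X Y f F y V s. \<Phi> V s) = \<Phi> V s"
proof -
  have "(case r of (V, s) \<Rightarrow> \<Phi> V s) = \<Phi> V s" if "r \<in> germ X Y f F y V s" for r
    using germ_memD[OF _ s] eq that by (cases r) auto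
  then have "(\<Union>r\<in>germ X Y f F y V s. case r of (V, s) \<Rightarrow> \<Phi> V s) = (\<Union>r\<in>germ X Y f F y V s. \<Phi> V s)"
    by (intro SUP_cong) auto
  also have "\<dots> = \<Phi> V s" using mem_germ[OF s y] by auto
  finally show ?thesis .
qed

section \<open>The sheaf space of the push forward and its topology\<close>

lemma gtop_push: "gtop (push G X Y f F) = push_space X Y f F"
  by (simp add: push_def)

lemma sproj_push [simp]: "sproj (push G X Y f F) = fst"
  by (simp add: push_def)

lemma pts_push:
  "pts (push G X Y f F) = {(y, germ X Y f F y V s) | y V s. push_section F V s \<and> y \<in> V}"
  unfolding gtop_push push_space_def push_section_def by auto

lemma germ_in_push:
  "push_section F V s \<Longrightarrow> y \<in> V \<Longrightarrow> (y, germ X Y f F y V s) \<in> pts (push G X Y f F)"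
  unfolding pts_push by blast

lemma push_cases:
  assumes "z \<in> pts (push G X Y f F)"
  obtains y V s where "push_section F V s" "y \<in> V" "z = (y, germ X Y f F y V s)"
  using assms unfolding pts_push by blast

lemma openin_push_germs:
  "push_section F V s \<Longrightarrow> openin (gtop (push G X Y f F)) ((\<lambda>y. (y, germ X Y f F y V s)) ` V)"
  unfolding gtop_push push_space_def push_section_def
  by (rule topology_generated_by_Basis) blast

text \<open>Continuity is tested on the generating sets, so it is enough to examine \<open>h\<close>
  near a point whose value lies in the image of a given section.\<close>

lemma continuous_map_into_push:
  assumes cl: "\<And>z. z \<in> topspace Z \<Longrightarrow> h z \<in> pts (push G X Y f F)"
    and loc: "\<And>z y V s. z \<in> topspace Z \<Longrightarrow> push_section F V s \<Longrightarrow> y \<in> V \<Longrightarrow>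
      h z = (y, germ X Y f F y V s) \<Longrightarrow>
      \<exists>N. openin Z N \<and> z \<in> N \<and> h ` N \<subseteq> (\<lambda>y. (y, germ X Y f F y V s)) ` V"
  shows "continuous_map Z (gtop (push G X Y f F)) h"
  unfolding gtop_push push_space_def continuous_on_generated_topo_iff
proof (intro conjI allI impI)
  fix U assume "U \<in> {(\<lambda>y. (y, germ X Y f F y V s)) ` V | V s.
    openin (gtop Y) V \<and> s \<in> push_sections X f F V}"
  then obtain V s where U: "U = (\<lambda>y. (y, germ X Y f F y V s)) ` V" and s: "push_section F V s"
    unfolding push_section_def by blast
  show "openin Z (h -` U \<inter> topspace Z)"
  proof (subst openin_subopen, rule ballI)
    fix z assume "z \<in> h -` U \<inter> topspace Z"
    then have z: "z \<in> topspace Z" "h z \<in> U" by auto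
    then obtain y where "y \<in> V" "h z = (y, germ X Y f F y V s)" using U by blast
    then obtain N where N: "openin Z N" "z \<in> N" "h ` N \<subseteq> U" using loc[OF z(1) s] U by blast
    then show "\<exists>T. openin Z T \<and> z \<in> T \<and> T \<subseteq> h -` U \<inter> topspace Z"
      using openin_subset[OF N(1)] by (intro exI[of _ N]) auto
  qed
next
  show "h ` topspace Z \<subseteq> \<Union> {(\<lambda>y. (y, germ X Y f F y V s)) ` V | V s.
    openin (gtop Y) V \<and> s \<in> push_sections X f F V}"
  proof (rule image_subsetI)
    fix z assume "z \<in> topspace Z"
    then obtain y V s where "push_section F V s" "y \<in> V" "h z = (y, germ X Y f F y V s)"
      using push_cases[OF cl] by metis
    then show "h z \<in> \<Union> {(\<lambda>y. (y, germ X Y f F y V s)) ` V | V s.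
      openin (gtop Y) V \<and> s \<in> push_sections X f F V}"
      unfolding push_section_def by auto
  qed
qed

text \<open>If \<open>s\<close> and \<open>t\<close> have the same germ at \<open>y\<close>, they
  agree over a whole neighbourhood \<open>W\<close>, so their germs coincide at every point of
  \<open>W\<close>. These sections serve as local inverses of the projection and as test sections
  for maps out of the sheaf space.\<close>

lemma germ_sections:
  assumes s: "push_section F V s"
  shows "(\<lambda>y\<in>V. (y, germ X Y f F y V s)) \<in> sections Y (push G X Y f F) V"
proof (rule sectionsI)
  let ?Z = "subtopology (gtop Y) V"
  have V: "openin (gtop Y) V" using s by (rule push_section_openin)
  show "continuous_map ?Z (gtop (push G X Y f F)) (\<lambda>y\<in>V. (y, germ X Y f F y V s))"
  proof (rule continuous_map_into_push)
    show "(\<lambda>y\<in>V. (y, germ X Y f F y V s)) z \<in> pts (push G X Y f F)" if "z \<in> topspace ?Z" for z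
      using that germ_in_push[OF s] by auto
  next
    fix z y V' t
    assume z: "z \<in> topspace ?Z" and t: "push_section F V' t" and y: "y \<in> V'"
      and eq: "(\<lambda>y\<in>V. (y, germ X Y f F y V s)) z = (y, germ X Y f F y V' t)"
    from z have "z \<in> V" by simp
    with eq have "z = y" and eq': "germ X Y f F y V s = germ X Y f F y V' t" by auto
    obtain W where W: "openin (gtop Y) W" "y \<in> W" "W \<subseteq> V \<inter> V'" "\<forall>x\<in>preim X f W. s x = t x"
      using germ_eqE[OF eq' t y] by blast
    have "(\<lambda>y\<in>V. (y, germ X Y f F y V s)) ` W \<subseteq> (\<lambda>y. (y, germ X Y f F y V' t)) ` V'"
    proof (rule image_subsetI)
      fix w assume w: "w \<in> W"
      have "germ X Y f F w V s = germ X Y f F w V' t" by (rule germ_eqI[OF s t W(1) w W(3)]) (use W(4) in blast)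
      then show "(\<lambda>y\<in>V. (y, germ X Y f F y V s)) w \<in> (\<lambda>y. (y, germ X Y f F y V' t)) ` V'"
        using w W by auto
    qed
    moreover have "openin ?Z W" using W V by (simp add: openin_open_subtopology)
    ultimately show "\<exists>N. openin ?Z N \<and> z \<in> N \<and>
        (\<lambda>y\<in>V. (y, germ X Y f F y V s)) ` N \<subseteq> (\<lambda>y. (y, germ X Y f F y V' t)) ` V'"
      using W \<open>z = y\<close> by blast
  qed
qed auto

section \<open>The action of the group on germs\<close>

text \<open>Independence of the representative: sections agreeing over the preimage of
  \<open>W\<close> have translates agreeing over the preimage of \<open>gW\<close>, because that
  preimage is the translate of the preimage of \<open>W\<close>.\<close>

lemma act_push_germ:
  assumes F: "is_gsheaf G X F" and g: "g \<in> carrier G" and s: "push_section F V s" and y: "y \<in> V"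
  shows "act (push G X Y f F) g (y, germ X Y f F y V s) =
    (act Y g y, germ X Y f F (act Y g y) (act Y g ` V) (translate G X F g (preim X f V) s))"
proof -
  have "(\<Union>(V, s)\<in>germ X Y f F y V s.
      germ X Y f F (act Y g y) (act Y g ` V) (translate G X F g (preim X f V) s)) =
    germ X Y f F (act Y g y) (act Y g ` V) (translate G X F g (preim X f V) s)"
  proof (rule UN_germ[OF s y])
    fix V' t assume t: "push_section F V' t" "y \<in> V'" "germ X Y f F y V' t = germ X Y f F y V s"
    obtain W where W: "openin (gtop Y) W" "y \<in> W" "W \<subseteq> V' \<inter> V" "\<forall>x\<in>preim X f W. t x = s x"
      using germ_eqE[OF t(3) s y] by blast
    show "germ X Y f F (act Y g y) (act Y g ` V') (translate G X F g (preim X f V') t) =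
      germ X Y f F (act Y g y) (act Y g ` V) (translate G X F g (preim X f V) s)"
    proof (rule germ_eqI[OF push_section_translate[OF F g t(1)] push_section_translate[OF F g s]])
      show "openin (gtop Y) (act Y g ` W)" by (rule openin_act_image[OF Y topspace_group g W(1)])
      fix x assume "x \<in> preim X f (act Y g ` W)"
      then obtain w where w: "w \<in> preim X f W" "x = act X g w"
        using preim_act[OF g openin_subset[OF W(1)]] by auto
      then have "w \<in> preim X f V" "w \<in> preim X f V'" using W(3) by auto
      then show "translate G X F g (preim X f V') t x = translate G X F g (preim X f V) s x"
        using w W(4) translate_act[OF X g, of _ w] by (metis (no_types, lifting) mem_Collect_eq subsetI)
    qed (use W in auto)
  qed
  then show ?thesis using germ_in_push[OF s y] by (simp add: push_def)
qed

lemma push_map_germ: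
  assumes h: "h \<in> gsheaf_hom G F F'" and s: "push_section F V s" and y: "y \<in> V"
  shows "push_map X Y f F F' h (y, germ X Y f F y V s) =
    (y, germ X Y f F' y V (compose (preim X f V) h s))"
proof -
  have "(\<Union>(V, s)\<in>germ X Y f F y V s. germ X Y f F' y V (compose (preim X f V) h s)) =
    germ X Y f F' y V (compose (preim X f V) h s)"
  proof (rule UN_germ[OF s y])
    fix V' t assume t: "push_section F V' t" "y \<in> V'" "germ X Y f F y V' t = germ X Y f F y V s"
    obtain W where W: "openin (gtop Y) W" "y \<in> W" "W \<subseteq> V' \<inter> V" "\<forall>x\<in>preim X f W. t x = s x"
      using germ_eqE[OF t(3) s y] by blast
    show "germ X Y f F' y V' (compose (preim X f V') h t) = germ X Y f F' y V (compose (preim X f V) h s)"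
      by (rule germ_eqI[OF push_section_compose[OF h t(1)] push_section_compose[OF h s] W(1-3)])
        (use W in \<open>auto simp: compose_def\<close>)
  qed
  then show ?thesis using germ_in_push[OF s y] by (simp add: push_map_def gtop_push)
qed

text \<open>The core of continuity of the action. The hypothesis concerns the single element
  \<open>g\<^sub>0\<close>; agreement spreads to nearby elements through openness of the equalizer
  of \<open>g s(x)\<close> and \<open>t(g x)\<close>, and the tube makes the neighbourhood of
  \<open>g\<^sub>0\<close> independent of the point in the fibre.\<close>

lemma translate_germ_nearby:
  assumes F: "is_gsheaf G X F" and s: "push_section F V s" and t: "push_section F V' t"
    and y0: "y\<^sub>0 \<in> V" and g0: "g\<^sub>0 \<in> carrier G" and gy0: "act Y g\<^sub>0 y\<^sub>0 \<in> V'"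
    and eq: "germ X Y f F (act Y g\<^sub>0 y\<^sub>0) (act Y g\<^sub>0 ` V) (translate G X F g\<^sub>0 (preim X f V) s) =
      germ X Y f F (act Y g\<^sub>0 y\<^sub>0) V' t"
  obtains N V1 where "openin (group_topology G) N" "g\<^sub>0 \<in> N" "openin (gtop Y) V1" "y\<^sub>0 \<in> V1" "V1 \<subseteq> V"
    "\<forall>g\<in>N. \<forall>y\<in>V1. act Y g y \<in> V' \<and>
      germ X Y f F (act Y g y) (act Y g ` V) (translate G X F g (preim X f V) s) =
      germ X Y f F (act Y g y) V' t"
proof -
  let ?T = "group_topology G"
  note V = push_section_openin[OF s] and V' = push_section_openin[OF t]
  note s' = push_section_sections[OF s] and t' = push_section_sections[OF t]
  have g0': "g\<^sub>0 \<in> topspace ?T" using g0 topspace_group by simp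
  have y0': "y\<^sub>0 \<in> pts Y" using y0 push_section_subset[OF s] by blast
  obtain W where W: "openin (gtop Y) W" "act Y g\<^sub>0 y\<^sub>0 \<in> W" "W \<subseteq> act Y g\<^sub>0 ` V \<inter> V'"
    and Weq: "\<forall>x\<in>preim X f W. translate G X F g\<^sub>0 (preim X f V) s x = t x"
    using germ_eqE[OF eq t gy0] by blast
  \<comment> \<open>Continuity of the action on \<open>Y\<close> gives \<open>N2\<close> and
    \<open>V2\<close> with \<open>act Y g y\<close> in \<open>W\<close>, hence in \<open>V'\<close>.
    Thus \<open>t\<close> is defined at \<open>g x\<close> for all \<open>(g, x)\<close> in
    \<open>?P\<close>.\<close>
  have "openin (prod_topology ?T (gtop Y)) {z \<in> topspace (prod_topology ?T (gtop Y)). (\<lambda>(g, y). act Y g y) z \<in> W}"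
    using gspace_act_continuous[OF Y] W(1) by (rule openin_continuous_map_preimage)
  moreover have "(g\<^sub>0, y\<^sub>0) \<in> {z \<in> topspace (prod_topology ?T (gtop Y)). (\<lambda>(g, y). act Y g y) z \<in> W}"
    using g0 y0' W topspace_group by auto
  ultimately obtain N2 V2 where N2: "openin ?T N2" "g\<^sub>0 \<in> N2" and V2: "openin (gtop Y) V2" "y\<^sub>0 \<in> V2"
    and NV2: "N2 \<times> V2 \<subseteq> {z \<in> topspace (prod_topology ?T (gtop Y)). (\<lambda>(g, y). act Y g y) z \<in> W}"
    unfolding openin_prod_topology_alt by meson
  have NV2W: "act Y g y \<in> W" if "g \<in> N2" "y \<in> V2" for g y
    using that NV2 by auto
  let ?P = "N2 \<times> preim X f (V \<inter> V2)"
  let ?Z = "subtopology (prod_topology ?T (gtop X)) ?P"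
  have P: "openin (prod_topology ?T (gtop X)) ?P"
    using N2 openin_preim[OF openin_Int[OF V V2(1)]] by (simp add: openin_prod_Times_iff)
  have top: "topspace ?Z = ?P" using openin_subset[OF P] by auto
  have carrier: "g \<in> carrier G" if "g \<in> N2" for g
    using that openin_subset[OF N2(1)] topspace_group by auto
  have act_preim: "act X g x \<in> preim X f V'" "act X g x \<in> preim X f W" if "(g, x) \<in> ?P" for g x
    using that f_act carrier NV2W W(3) gspace_act_closed[OF X] by auto
  have ppF: "continuous_map (prod_topology ?T (gtop F)) (gtop F) (\<lambda>(g, x). act F g x)"
    and ppX: "continuous_map (prod_topology ?T (gtop X)) (gtop X) (\<lambda>(g, x). act X g x)"
    using gspace_act_continuous gsheaf_gspace[OF F] X by blast+
  have Zfst: "continuous_map ?Z ?T fst"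
    by (rule continuous_map_from_subtopology[OF continuous_map_fst])
  have Zsnd: "continuous_map ?Z (subtopology (gtop X) (preim X f V)) snd"
    unfolding continuous_map_in_subtopology
    using continuous_map_from_subtopology[OF continuous_map_snd] top by auto
  have Zact: "continuous_map ?Z (subtopology (gtop X) (preim X f V')) (\<lambda>(g, x). act X g x)"
    unfolding continuous_map_in_subtopology
    using continuous_map_from_subtopology[OF ppX] act_preim top by auto
  \<comment> \<open>The two sides of the comparison. Both lie over \<open>g x\<close>, so the
    equalizer criterion applies.\<close>
  let ?a = "\<lambda>z. act F (fst z) (s (snd z))" and ?b = "\<lambda>z. t (act X (fst z) (snd z))"
  have Zs: "continuous_map ?Z (gtop F) (\<lambda>z. s (snd z))"
    using continuous_map_compose[OF Zsnd sections_continuous[OF s']] by (simp add: o_def)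
  have a: "continuous_map ?Z (gtop F) ?a"
    using continuous_map_compose[OF continuous_map_pairedI[OF Zfst Zs] ppF] by (simp add: o_def)
  have b: "continuous_map ?Z (gtop F) ?b"
    using continuous_map_compose[OF Zact sections_continuous[OF t']] by (simp add: o_def split_beta)
  have "openin ?Z {z \<in> topspace ?Z. ?a z = ?b z}"
  proof (rule openin_local_homeomorphism_equalizer[OF gsheaf_sproj_local_homeomorphism[OF F] a b])
    fix z assume "z \<in> topspace ?Z"
    then have z: "z \<in> ?P" using top by simp
    then have "s (snd z) \<in> pts F" "sproj F (s (snd z)) = snd z"
      using sections_closed[OF s', of "snd z"] sections_sproj[OF s', of "snd z"] by auto
    moreover have "sproj F (t (act X (fst z) (snd z))) = act X (fst z) (snd z)"
      using sections_sproj[OF t' act_preim(1)[of "fst z" "snd z"]] z by simp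
    ultimately show "sproj F (?a z) = sproj F (?b z)"
      using gsheaf_sproj_act[OF F] carrier z by auto
  qed
  then have O: "openin (prod_topology ?T (gtop X)) {z \<in> ?P. ?a z = ?b z}"
    unfolding top using P by (rule openin_trans_full)
  \<comment> \<open>Equality of germs at \<open>g\<^sub>0\<close> covers the entire fibre over
    \<open>y\<^sub>0\<close>: its translate lies in the preimage of \<open>W\<close>, where the two
    sections agree.\<close>
  have fib: "(g\<^sub>0, x) \<in> {z \<in> ?P. ?a z = ?b z}" if x: "x \<in> pts X" "f x = y\<^sub>0" for x
  proof -
    have "(g\<^sub>0, x) \<in> ?P" using x y0 N2(2) V2(2) by simp
    moreover have "translate G X F g\<^sub>0 (preim X f V) s (act X g\<^sub>0 x) = act F g\<^sub>0 (s x)"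
      using x y0 by (intro translate_act[OF X g0]) auto
    ultimately show ?thesis using bspec[OF Weq act_preim(2)] by auto
  qed
  obtain N V1 where N: "openin ?T N" "g\<^sub>0 \<in> N" "openin (gtop Y) V1" "y\<^sub>0 \<in> V1"
    and tube: "\<forall>g\<in>N. \<forall>x\<in>pts X. f x \<in> V1 \<longrightarrow> (g, x) \<in> {z \<in> ?P. ?a z = ?b z}"
    by (rule proper_map_tube[OF proper O g0' y0' fib])
  show thesis
  proof
    show "openin ?T (N \<inter> N2)" "g\<^sub>0 \<in> N \<inter> N2" using N N2 by auto
    show "openin (gtop Y) (V1 \<inter> V2 \<inter> V)" "y\<^sub>0 \<in> V1 \<inter> V2 \<inter> V" "V1 \<inter> V2 \<inter> V \<subseteq> V"
      using N V2 V y0 by auto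
    show "\<forall>g\<in>N \<inter> N2. \<forall>y\<in>V1 \<inter> V2 \<inter> V. act Y g y \<in> V' \<and>
      germ X Y f F (act Y g y) (act Y g ` V) (translate G X F g (preim X f V) s) =
      germ X Y f F (act Y g y) V' t"
    proof (intro ballI)
      fix g y assume g: "g \<in> N \<inter> N2" and y: "y \<in> V1 \<inter> V2 \<inter> V"
      have gG: "g \<in> carrier G" using carrier g by blast
      have gyW: "act Y g y \<in> W" using NV2W g y by blast
      have "germ X Y f F (act Y g y) (act Y g ` V) (translate G X F g (preim X f V) s) =
          germ X Y f F (act Y g y) V' t"
      proof (rule germ_eqI[OF push_section_translate[OF F gG s] t])
        have op: "openin (gtop Y) (V1 \<inter> V2 \<inter> V)" using N V2 V by auto
        show "openin (gtop Y) (act Y g ` (V1 \<inter> V2 \<inter> V))"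
          by (rule openin_act_image[OF Y topspace_group gG op])
        show "act Y g y \<in> act Y g ` (V1 \<inter> V2 \<inter> V)" using y by blast
        show "act Y g ` (V1 \<inter> V2 \<inter> V) \<subseteq> act Y g ` V \<inter> V'" using NV2W g W(3) by auto
        \<comment> \<open>Back from points to germs: each point over the translated neighbourhood is
          \<open>g w\<close>, and the tube condition at \<open>(g, w)\<close> is exactly the
          required equality.\<close>
        fix x assume "x \<in> preim X f (act Y g ` (V1 \<inter> V2 \<inter> V))"
        then obtain w where w: "w \<in> preim X f (V1 \<inter> V2 \<inter> V)" "x = act X g w"
          using preim_act[OF gG openin_subset[OF op]] by auto
        have "translate G X F g (preim X f V) s (act X g w) = act F g (s w)"
          using w by (intro translate_act[OF X gG]) auto
        moreover have "act F g (s w) = t (act X g w)" using tube g w by auto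
        ultimately show "translate G X F g (preim X f V) s x = t x" using w by simp
      qed
      then show "act Y g y \<in> V' \<and>
        germ X Y f F (act Y g y) (act Y g ` V) (translate G X F g (preim X f V) s) =
        germ X Y f F (act Y g y) V' t" using gyW W(3) by blast
    qed
  qed
qed

lemma act_push_closed:
  assumes F: "is_gsheaf G X F" and g: "g \<in> carrier G" and z: "z \<in> pts (push G X Y f F)"
  shows "act (push G X Y f F) g z \<in> pts (push G X Y f F)"
  using z
proof (cases rule: push_cases)
  case (1 y V s)
  then show ?thesis
    using act_push_germ[OF F g 1(1,2)] germ_in_push[OF push_section_translate[OF F g 1(1)]] by simp
qed

lemma continuous_map_act_push:
  assumes F: "is_gsheaf G X F"
  shows "continuous_map (prod_topology (group_topology G) (gtop (push G X Y f F))) (gtop (push G X Y f F))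
    (\<lambda>(g, z). act (push G X Y f F) g z)" (is "continuous_map ?Z _ ?act")
proof (rule continuous_map_into_push)
  show "?act z \<in> pts (push G X Y f F)" if "z \<in> topspace ?Z" for z
    using that act_push_closed[OF F] topspace_group by auto
next
  fix z y V' t
  assume z: "z \<in> topspace ?Z" and t: "push_section F V' t" and y: "y \<in> V'"
    and eq: "?act z = (y, germ X Y f F y V' t)"
  obtain g0 p where gp: "z = (g0, p)" "g0 \<in> carrier G" "p \<in> pts (push G X Y f F)"
    using z topspace_group by auto
  from gp(3) obtain y0 V s where s: "push_section F V s" and y0: "y0 \<in> V" and p: "p = (y0, germ X Y f F y0 V s)"
    by (rule push_cases)
  have y': "act Y g0 y0 = y" and
    "germ X Y f F (act Y g0 y0) (act Y g0 ` V) (translate G X F g0 (preim X f V) s) =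
      germ X Y f F (act Y g0 y0) V' t"
    using eq act_push_germ[OF F gp(2) s y0] gp(1) p by auto
  then obtain N V1 where N: "openin (group_topology G) N" "g0 \<in> N" "openin (gtop Y) V1" "y0 \<in> V1" "V1 \<subseteq> V"
    and NV1: "\<forall>g\<in>N. \<forall>y\<in>V1. act Y g y \<in> V' \<and>
      germ X Y f F (act Y g y) (act Y g ` V) (translate G X F g (preim X f V) s) =
      germ X Y f F (act Y g y) V' t"
    using translate_germ_nearby[OF F s t y0 gp(2)] y by blast
  \<comment> \<open>Restricting to \<open>V1\<close> leaves the germs unchanged but makes the image
    of the section a neighbourhood of \<open>p\<close> on which the uniform statement holds for
    every \<open>g\<close> in \<open>N\<close>.\<close>
  let ?r = "restrict s (preim X f V1)"
  let ?U = "(\<lambda>y. (y, germ X Y f F y V1 ?r)) ` V1"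
  have U: "openin (gtop (push G X Y f F)) ?U"
    by (rule openin_push_germs[OF push_section_restrict[OF s N(3,5)]])
  have r: "germ X Y f F y V1 ?r = germ X Y f F y V s" if "y \<in> V1" for y
    using germ_restrict[OF s N(3,5) that] .
  have "openin ?Z (N \<times> ?U)" using N U by (simp add: openin_prod_Times_iff)
  moreover have "z \<in> N \<times> ?U" using gp p N r by auto
  moreover have "?act ` (N \<times> ?U) \<subseteq> (\<lambda>y. (y, germ X Y f F y V' t)) ` V'"
  proof (rule image_subsetI)
    fix u assume "u \<in> N \<times> ?U"
    then obtain g y where g: "g \<in> N" and y: "y \<in> V1" and u: "u = (g, (y, germ X Y f F y V1 ?r))" by blast
    have "g \<in> carrier G" using g openin_subset[OF N(1)] topspace_group by blast
    then have "act (push G X Y f F) g (y, germ X Y f F y V1 ?r) = (act Y g y, germ X Y f F (act Y g y) V' t)"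
      using act_push_germ[OF F _ s] r[OF y] bspec[OF bspec[OF NV1 g] y] y N(5) by (simp add: subset_iff)
    then show "?act u \<in> (\<lambda>y. (y, germ X Y f F y V' t)) ` V'"
      using bspec[OF bspec[OF NV1 g] y] u by simp
  qed
  ultimately show "\<exists>N. openin ?Z N \<and> z \<in> N \<and> ?act ` N \<subseteq> (\<lambda>y. (y, germ X Y f F y V' t)) ` V'"
    by blast
qed

lemma is_gspace_push:
  assumes F: "is_gsheaf G X F"
  shows "is_gspace G (push G X Y f F)"
proof (rule is_gspaceI)
  show "group G" using X by (rule gspace_group)
  then interpret group G .
  show "act (push G X Y f F) g z \<in> pts (push G X Y f F)"
    if "g \<in> carrier G" "z \<in> pts (push G X Y f F)" for g z
    using act_push_closed[OF F that] .
  show "act (push G X Y f F) \<one>\<^bsub>G\<^esub> z = z" if z: "z \<in> pts (push G X Y f F)" for z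
    using z
  proof (cases rule: push_cases)
    case (1 y V s)
    have one: "\<one>\<^bsub>G\<^esub> \<in> carrier G" by simp
    have V: "act Y \<one>\<^bsub>G\<^esub> ` V = V"
      using push_section_subset[OF 1(1)] gspace_act_one[OF Y] by (force simp: subset_iff)
    have y: "act Y \<one>\<^bsub>G\<^esub> y = y"
      using push_section_subset[OF 1(1)] 1(2) gspace_act_one[OF Y] by blast
    have "germ X Y f F y V (translate G X F \<one>\<^bsub>G\<^esub> (preim X f V) s) = germ X Y f F y V s"
    proof (rule germ_eqI[OF _ 1(1) push_section_openin[OF 1(1)] 1(2)])
      show "push_section F V (translate G X F \<one>\<^bsub>G\<^esub> (preim X f V) s)"
        using push_section_translate[OF F one 1(1)] V by simp
      fix x assume x: "x \<in> preim X f V"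
      then show "translate G X F \<one>\<^bsub>G\<^esub> (preim X f V) s x = s x"
        using translate_act[OF X one, of "preim X f V" x F s] gspace_act_one[OF X]
          gspace_act_one[OF gsheaf_gspace[OF F]] sections_closed[OF push_section_sections[OF 1(1)] _ x] by auto
    qed simp
    then show ?thesis using act_push_germ[OF F one 1(1,2)] 1(3) V y by simp
  qed
  show "act (push G X Y f F) (g \<otimes>\<^bsub>G\<^esub> h) z = act (push G X Y f F) g (act (push G X Y f F) h z)"
    if g: "g \<in> carrier G" and h: "h \<in> carrier G" and z: "z \<in> pts (push G X Y f F)" for g h z
    using z
  proof (cases rule: push_cases)
    case (1 y V s)
    note sub = push_section_subset[OF 1(1)]
    let ?hs = "translate G X F h (preim X f V) s"
    let ?ghs = "translate G X F g (preim X f (act Y h ` V)) ?hs"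
    have gh: "g \<otimes>\<^bsub>G\<^esub> h \<in> carrier G" using g h by simp
    have hs: "push_section F (act Y h ` V) ?hs" by (rule push_section_translate[OF F h 1(1)])
    have ghs: "push_section F (act Y g ` act Y h ` V) ?ghs" by (rule push_section_translate[OF F g hs])
    have V: "act Y (g \<otimes>\<^bsub>G\<^esub> h) ` V = act Y g ` act Y h ` V"
      unfolding image_image using sub gspace_act_mult[OF Y g h] by (intro image_cong) auto
    have y: "act Y (g \<otimes>\<^bsub>G\<^esub> h) y = act Y g (act Y h y)"
      using sub 1(2) gspace_act_mult[OF Y g h] by blast
    have "germ X Y f F (act Y g (act Y h y)) (act Y g ` act Y h ` V) (translate G X F (g \<otimes>\<^bsub>G\<^esub> h) (preim X f V) s) =
      germ X Y f F (act Y g (act Y h y)) (act Y g ` act Y h ` V) ?ghs"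
    proof (rule germ_eqI[OF _ ghs push_section_openin[OF ghs]])
      show "push_section F (act Y g ` act Y h ` V) (translate G X F (g \<otimes>\<^bsub>G\<^esub> h) (preim X f V) s)"
        using push_section_translate[OF F gh 1(1)] V by simp
      show "act Y g (act Y h y) \<in> act Y g ` act Y h ` V" using 1(2) by blast
      \<comment> \<open>Writing \<open>x\<close> as the translate of \<open>w\<close> by the product
        reduces the comparison of the two translates to the action law in \<open>F\<close> at
        \<open>s w\<close>.\<close>
      fix x assume x: "x \<in> preim X f (act Y g ` act Y h ` V)"
      then obtain w where w: "w \<in> preim X f V" "x = act X (g \<otimes>\<^bsub>G\<^esub> h) w"
        using preim_act[OF gh sub] V by auto
      then have w': "w \<in> pts X" by auto
      have hw: "act X h w \<in> preim X f (act Y h ` V)" using preim_act[OF h sub] w(1) by blast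
      have "?ghs x = act F g (?hs (act X h w))"
        using gspace_act_mult[OF X g h w'] w(2) translate_act[OF X g _ hw] by auto
      also have "\<dots> = act F g (act F h (s w))"
        using translate_act[OF X h _ w(1), of F s] by auto
      also have "\<dots> = act F (g \<otimes>\<^bsub>G\<^esub> h) (s w)"
        using gspace_act_mult[OF gsheaf_gspace[OF F] g h] sections_closed[OF push_section_sections[OF 1(1)] _ w(1)]
        by auto
      also have "\<dots> = translate G X F (g \<otimes>\<^bsub>G\<^esub> h) (preim X f V) s x"
        using translate_act[OF X gh _ w(1), of F s] w(2) by auto
      finally show "translate G X F (g \<otimes>\<^bsub>G\<^esub> h) (preim X f V) s x = ?ghs x" ..
    qed simp
    then show ?thesis
      using act_push_germ[OF F gh 1(1,2)] act_push_germ[OF F h 1(1,2)]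
        act_push_germ[OF F g hs, of "act Y h y"] 1(2,3) V y by simp
  qed
  show "act (push G X Y f F) g \<in> extensional (pts (push G X Y f F))" for g
    by (simp add: push_def)
qed (rule continuous_map_act_push[OF F])

section \<open>The push forward as a sheaf with group action\<close>

text \<open>A germ over a point of \<open>U\<close> has a representative over a subset of
  \<open>U\<close>, and the image of that representative is an open set lying over
  \<open>U\<close>.\<close>

lemma continuous_map_push_fst: "continuous_map (gtop (push G X Y f F)) (gtop Y) fst"
  unfolding continuous_map_def
proof (intro conjI allI impI)
  show "fst \<in> pts (push G X Y f F) \<rightarrow> pts Y"
    using push_section_subset unfolding pts_push by fastforce
  fix U assume U: "openin (gtop Y) U"
  show "openin (gtop (push G X Y f F)) {z \<in> pts (push G X Y f F). fst z \<in> U}"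
  proof (subst openin_subopen, safe)
    fix y \<gamma> assume z: "(y, \<gamma>) \<in> pts (push G X Y f F)" and yU: "fst (y, \<gamma>) \<in> U"
    obtain V s where s: "push_section F V s" and y: "y \<in> V" "y \<in> U" "(y, \<gamma>) = (y, germ X Y f F y V s)"
      using push_cases[OF z] yU by (metis fst_conv)
    let ?r = "restrict s (preim X f (U \<inter> V))" and ?W = "U \<inter> V"
    have W: "openin (gtop Y) ?W" "?W \<subseteq> V" using U push_section_openin[OF s] by auto
    have r: "push_section F ?W ?r" using s W by (rule push_section_restrict)
    have "openin (gtop (push G X Y f F)) ((\<lambda>y. (y, germ X Y f F y ?W ?r)) ` ?W)"
      by (rule openin_push_germs[OF r])
    moreover have "(y, \<gamma>) \<in> (\<lambda>y. (y, germ X Y f F y ?W ?r)) ` ?W"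
      using germ_restrict[OF s W, of y] y by auto
    moreover have "(\<lambda>y. (y, germ X Y f F y ?W ?r)) ` ?W \<subseteq> {z \<in> pts (push G X Y f F). fst z \<in> U}"
      using germ_in_push[OF r] by auto
    ultimately show "\<exists>T. openin (gtop (push G X Y f F)) T \<and> (y, \<gamma>) \<in> T \<and>
        T \<subseteq> {z \<in> pts (push G X Y f F). fst z \<in> U}" by blast
  qed
qed

lemma is_gsheaf_push:
  assumes F: "is_gsheaf G X F"
  shows "is_gsheaf G Y (push G X Y f F)"
  unfolding is_gsheaf_def
proof (intro conjI)
  show "is_gspace G (push G X Y f F)" by (rule is_gspace_push[OF F])
  show "equivariant_map G (push G X Y f F) Y (sproj (push G X Y f F))"
    unfolding equivariant_map_def
  proof (intro conjI ballI)
    fix g z assume g: "g \<in> carrier G" and "z \<in> pts (push G X Y f F)"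
    from this(2) show "sproj (push G X Y f F) (act (push G X Y f F) g z) = act Y g (sproj (push G X Y f F) z)"
      by (rule push_cases) (simp add: act_push_germ[OF F g])
  qed (simp add: continuous_map_push_fst)
  show "local_homeomorphism (gtop (push G X Y f F)) (gtop Y) (sproj (push G X Y f F))"
  proof (rule local_homeomorphismI)
    fix z assume "z \<in> pts (push G X Y f F)"
    then obtain y V s where s: "push_section F V s" and y: "y \<in> V" "z = (y, germ X Y f F y V s)"
      by (rule push_cases)
    let ?U = "(\<lambda>y. (y, germ X Y f F y V s)) ` V"
    have U: "sproj (push G X Y f F) ` ?U = V" by force
    show "\<exists>U \<sigma>. openin (gtop (push G X Y f F)) U \<and> z \<in> U \<and> openin (gtop Y) (sproj (push G X Y f F) ` U) \<and>
        continuous_map (subtopology (gtop Y) (sproj (push G X Y f F) ` U)) (gtop (push G X Y f F)) \<sigma> \<and>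
        (\<forall>u\<in>U. \<sigma> (sproj (push G X Y f F) u) = u)"
    proof (intro exI conjI)
      show "openin (gtop (push G X Y f F)) ?U" by (rule openin_push_germs[OF s])
      show "openin (gtop Y) (sproj (push G X Y f F) ` ?U)" unfolding U by (rule push_section_openin[OF s])
      show "continuous_map (subtopology (gtop Y) (sproj (push G X Y f F) ` ?U)) (gtop (push G X Y f F))
          (\<lambda>y\<in>V. (y, germ X Y f F y V s))"
        unfolding U by (rule sections_continuous[OF germ_sections[OF s]])
    qed (use y in auto)
  qed (simp add: continuous_map_push_fst)
qed

section \<open>Functoriality of the push forward\<close>

lemma push_map_hom:
  assumes F: "is_gsheaf G X F" and F': "is_gsheaf G X F'" and h: "h \<in> gsheaf_hom G F F'"
  shows "push_map X Y f F F' h \<in> gsheaf_hom G (push G X Y f F) (push G X Y f F')"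
proof (rule gsheaf_homI)
  show "continuous_map (gtop (push G X Y f F)) (gtop (push G X Y f F')) (push_map X Y f F F' h)"
  proof (rule continuous_map_if_on_sections[OF is_gsheaf_push[OF F]])
    fix z assume "z \<in> pts (push G X Y f F)"
    then obtain y V s where s: "push_section F V s" and y: "y \<in> V" "z = (y, germ X Y f F y V s)"
      by (rule push_cases)
    have "continuous_map (subtopology (gtop Y) V) (gtop (push G X Y f F'))
        (push_map X Y f F F' h \<circ> (\<lambda>y\<in>V. (y, germ X Y f F y V s)))"
      by (rule continuous_map_eq[OF sections_continuous[OF germ_sections[OF push_section_compose[OF h s]]]])
        (simp add: push_map_germ[OF h s])
    then show "\<exists>U \<sigma>. openin (gtop Y) U \<and> \<sigma> \<in> sections Y (push G X Y f F) U \<and>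
        sproj (push G X Y f F) z \<in> U \<and> \<sigma> (sproj (push G X Y f F) z) = z \<and>
        continuous_map (subtopology (gtop Y) U) (gtop (push G X Y f F')) (push_map X Y f F F' h \<circ> \<sigma>)"
      using push_section_openin[OF s] germ_sections[OF s] y
      by (intro exI[of _ V] exI[of _ "\<lambda>y\<in>V. (y, germ X Y f F y V s)"]) auto
  qed
  fix z assume z: "z \<in> pts (push G X Y f F)"
  then obtain y V s where s: "push_section F V s" and y: "y \<in> V" "z = (y, germ X Y f F y V s)"
    by (rule push_cases)
  show "sproj (push G X Y f F') (push_map X Y f F F' h z) = sproj (push G X Y f F) z"
    using push_map_germ[OF h s] y by simp
  fix g assume g: "g \<in> carrier G"
  note gs = push_section_translate[OF F g s] and hs = push_section_compose[OF h s]
  have gy: "act Y g y \<in> act Y g ` V" using y by blast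
  \<comment> \<open>Composing with \<open>h\<close> commutes with translating: at
    \<open>x = g w\<close> the two sides are \<open>h (g s(w))\<close> and
    \<open>g h(s(w))\<close>.\<close>
  have "germ X Y f F' (act Y g y) (act Y g ` V) (compose (preim X f (act Y g ` V)) h (translate G X F g (preim X f V) s)) =
    germ X Y f F' (act Y g y) (act Y g ` V) (translate G X F' g (preim X f V) (compose (preim X f V) h s))"
  proof (rule germ_eqI[OF push_section_compose[OF h gs] push_section_translate[OF F' g hs] push_section_openin[OF gs] gy])
    fix x assume x: "x \<in> preim X f (act Y g ` V)"
    then obtain w where w: "w \<in> preim X f V" "x = act X g w"
      using preim_act[OF g push_section_subset[OF s]] by auto
    have "s w \<in> pts F" using sections_closed[OF push_section_sections[OF s] _ w(1)] by auto
    moreover have "translate G X F g (preim X f V) s x = act F g (s w)"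
      unfolding w(2) by (rule translate_act[OF X g _ w(1)]) auto
    moreover have "translate G X F' g (preim X f V) (compose (preim X f V) h s) x = act F' g (compose (preim X f V) h s w)"
      unfolding w(2) by (rule translate_act[OF X g _ w(1)]) auto
    ultimately show "compose (preim X f (act Y g ` V)) h (translate G X F g (preim X f V) s) x =
        translate G X F' g (preim X f V) (compose (preim X f V) h s) x"
      using x w(1) gsheaf_hom_act[OF h g] by (simp add: compose_eq)
  qed simp
  then show "push_map X Y f F F' h (act (push G X Y f F) g z) = act (push G X Y f F') g (push_map X Y f F F' h z)"
    using y act_push_germ[OF F g s] act_push_germ[OF F' g hs] push_map_germ[OF h s] push_map_germ[OF h gs gy] by simp
qed (simp add: push_map_def gtop_push)

lemma gsheaf_functor_push: "gsheaf_functor G X Y (push G X Y f) (\<lambda>F F' v. push_map X Y f F F' v)"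
  unfolding gsheaf_functor_def
proof (intro conjI allI impI ballI)
  fix F F' F'' :: "('g, 'e, 'x) gsheaf" and h k
  assume F: "is_gsheaf G X F" and h: "h \<in> gsheaf_hom G F F'" and k: "k \<in> gsheaf_hom G F' F''"
  note kh = gsheaf_hom_compose[OF gsheaf_gspace[OF F] h k]
  show "push_map X Y f F F'' (compose (pts F) k h) =
      compose (pts (push G X Y f F)) (push_map X Y f F' F'' k) (push_map X Y f F F' h)"
  proof (rule extensionalityI)
    fix z assume z: "z \<in> pts (push G X Y f F)"
    then obtain y V s where s: "push_section F V s" and y: "y \<in> V" "z = (y, germ X Y f F y V s)"
      by (rule push_cases)
    have "compose (preim X f V) (compose (pts F) k h) s = compose (preim X f V) k (compose (preim X f V) h s)"
      using sections_closed[OF push_section_sections[OF s]] by (auto simp: compose_def restrict_def fun_eq_iff)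
    then show "push_map X Y f F F'' (compose (pts F) k h) z =
        compose (pts (push G X Y f F)) (push_map X Y f F' F'' k) (push_map X Y f F F' h) z"
      using z y push_map_germ[OF kh s y(1)] push_map_germ[OF h s y(1)]
        push_map_germ[OF k push_section_compose[OF h s] y(1)] by (simp add: compose_eq)
  qed (simp_all add: push_map_def gtop_push)
next
  fix F :: "('g, 'e, 'x) gsheaf"
  assume F: "is_gsheaf G X F"
  have id: "(\<lambda>e\<in>pts F. e) \<in> gsheaf_hom G F F"
    by (rule gsheaf_homI)
      (auto simp: gspace_act_closed[OF gsheaf_gspace[OF F]] intro: continuous_map_eq[OF continuous_map_id])
  show "push_map X Y f F F (\<lambda>e\<in>pts F. e) = (\<lambda>e\<in>pts (push G X Y f F). e)"
  proof (rule extensionalityI)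
    fix z assume z: "z \<in> pts (push G X Y f F)"
    then obtain y V s where s: "push_section F V s" and y: "y \<in> V" "z = (y, germ X Y f F y V s)"
      by (rule push_cases)
    have "compose (preim X f V) (\<lambda>e\<in>pts F. e) s = s"
      using sections_closed[OF push_section_sections[OF s]] sections_extensional[OF push_section_sections[OF s]]
      by (auto simp: compose_def restrict_def fun_eq_iff extensional_def)
    then show "push_map X Y f F F (\<lambda>e\<in>pts F. e) z = (\<lambda>e\<in>pts (push G X Y f F). e) z"
      using z y push_map_germ[OF id s y(1)] by simp
  qed (simp_all add: push_map_def gtop_push)
qed (auto intro: is_gsheaf_push push_map_hom)

section \<open>The adjunction\<close>

abbreviation pulled_section :: "('x \<times> 'd \<Rightarrow> 'e) \<Rightarrow> 'y set \<Rightarrow> ('y \<Rightarrow> 'd) \<Rightarrow> 'x \<Rightarrow> 'e" where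
  "pulled_section h V \<sigma> \<equiv> compose (preim X f V) h (\<lambda>x \<in> preim X f V. (x, \<sigma> (f x)))"

text \<open>The local section through \<open>e\<close> is chosen separately at each point;
  \<open>adjunct_eq\<close> shows that the choice does not affect the value when \<open>h\<close> is
  a morphism.\<close>

definition adjunct ::
  "('g, 'd, 'y) gsheaf \<Rightarrow> ('g, 'e, 'x) gsheaf \<Rightarrow> ('x \<times> 'd \<Rightarrow> 'e) \<Rightarrow> 'd \<Rightarrow> 'y \<times> ('x, 'y, 'e) germ" where
  "adjunct E F h = (\<lambda>e\<in>pts E.
     let (V, \<sigma>) = SOME (V, \<sigma>). openin (gtop Y) V \<and> \<sigma> \<in> sections Y E V \<and>
           sproj E e \<in> V \<and> \<sigma> (sproj E e) = e
     in (sproj E e, germ X Y f F (sproj E e) V (pulled_section h V \<sigma>)))"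

text \<open>The value at \<open>x\<close> of any representative. It is meaningful only when
  \<open>x\<close> lies in the fibre over the base point of the germ, since representatives agree
  only over a neighbourhood of that point.\<close>

definition germ_value :: "'x \<Rightarrow> ('x, 'y, 'e) germ \<Rightarrow> 'e" where
  "germ_value x \<gamma> = snd (SOME r. r \<in> \<gamma>) x"

definition coadjunct ::
  "('g, 'd, 'y) gsheaf \<Rightarrow> ('d \<Rightarrow> 'y \<times> ('x, 'y, 'e) germ) \<Rightarrow> 'x \<times> 'd \<Rightarrow> 'e" where
  "coadjunct E k = (\<lambda>(x, e)\<in>pts (pull X f E). germ_value x (snd (k e)))"

lemma push_section_pulled:
  assumes h: "h \<in> gsheaf_hom G (pull X f E) F" and \<sigma>: "\<sigma> \<in> sections Y E V" and V: "openin (gtop Y) V"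
  shows "push_section F V (pulled_section h V \<sigma>)"
  by (rule push_sectionI[OF V compose_sections[OF h pull_section[OF \<sigma> V]]]) auto

text \<open>Two local sections of \<open>E\<close> with the same value at \<open>y\<close> agree
  near \<open>y\<close>, so the sections they induce agree over a preimage. As \<open>y\<close>
  ranges over all of \<open>V\<close>, the formula describes the transpose along the whole of
  \<open>\<sigma>\<close>, which is what continuity and equivariance require.\<close>

lemma adjunct_eq:
  assumes E: "is_gsheaf G Y E" and h: "h \<in> gsheaf_hom G (pull X f E) F"
    and V: "openin (gtop Y) V" and \<sigma>: "\<sigma> \<in> sections Y E V" and y: "y \<in> V"
  shows "adjunct E F h (\<sigma> y) = (y, germ X Y f F y V (pulled_section h V \<sigma>))"
proof -
  let ?P = "\<lambda>(V', \<tau>). openin (gtop Y) V' \<and> \<tau> \<in> sections Y E V' \<and> y \<in> V' \<and> \<tau> y = \<sigma> y"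
  obtain V' \<tau> where some: "(SOME r. ?P r) = (V', \<tau>)" by fastforce
  have "?P (SOME r. ?P r)" by (rule someI[of ?P "(V, \<sigma>)"]) (use assms in auto)
  then have V': "openin (gtop Y) V'" "\<tau> \<in> sections Y E V'" "y \<in> V'" "\<tau> y = \<sigma> y"
    unfolding some by auto
  obtain W where W: "openin (gtop Y) W" "y \<in> W" "W \<subseteq> V' \<inter> V" "\<forall>w\<in>W. \<tau> w = \<sigma> w"
    by (rule sections_agree_nearby[OF E V'(2) \<sigma> V'(1) V V'(3) y V'(4)])
  have "germ X Y f F y V' (pulled_section h V' \<tau>) = germ X Y f F y V (pulled_section h V \<sigma>)"
    by (rule germ_eqI[OF push_section_pulled[OF h V'(2,1)] push_section_pulled[OF h \<sigma> V] W(1-3)])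
      (use W(3,4) in \<open>auto simp: compose_def\<close>)
  moreover have "\<sigma> y \<in> pts E" "sproj E (\<sigma> y) = y"
    using sections_closed[OF \<sigma> openin_subset[OF V] y] sections_sproj[OF \<sigma> y] .
  ultimately show ?thesis using some by (simp add: adjunct_def)
qed

lemma germ_value_germ:
  assumes s: "push_section F V s" and x: "x \<in> preim X f V"
  shows "germ_value x (germ X Y f F (f x) V s) = s x"
proof -
  let ?\<gamma> = "germ X Y f F (f x) V s"
  obtain V' t where some: "(SOME r. r \<in> ?\<gamma>) = (V', t)" by fastforce
  have "(V, s) \<in> ?\<gamma>" using mem_germ[OF s] x by auto
  then have "(V', t) \<in> ?\<gamma>" unfolding some[symmetric] by (rule someI)
  then have "t x = s x" using x by (auto simp: germ_def)
  then show ?thesis by (simp add: germ_value_def some)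
qed

text \<open>The image of a local section of \<open>E\<close> under \<open>k\<close> and the section
  \<open>y \<mapsto> s_y\<close> given by a representative of \<open>k e\<close> are two sections of
  the push forward with the same value at one point, hence they agree nearby. So a single
  \<open>s\<close> represents \<open>k\<close> along a local section, not merely at
  \<open>e\<close>.\<close>

lemma push_hom_locally:
  assumes E: "is_gsheaf G Y E" and F: "is_gsheaf G X F"
    and k: "k \<in> gsheaf_hom G E (push G X Y f F)" and e: "e \<in> pts E"
  obtains W \<sigma> s where "openin (gtop Y) W" "\<sigma> \<in> sections Y E W" "sproj E e \<in> W" "\<sigma> (sproj E e) = e"
    "push_section F W s" "\<forall>y\<in>W. k (\<sigma> y) = (y, germ X Y f F y W s)"
proof -
  obtain U \<tau> where U: "openin (gtop Y) U" and \<tau>: "\<tau> \<in> sections Y E U"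
    and eU: "sproj E e \<in> U" "\<tau> (sproj E e) = e"
    using gsheaf_section_through[OF E e] by metis
  obtain y V s where s: "push_section F V s" and y: "y \<in> V" "k e = (y, germ X Y f F y V s)"
    by (rule push_cases[OF gsheaf_hom_closed[OF k e]])
  have ye: "sproj E e = y" using gsheaf_hom_sproj[OF k e] y by simp
  have yU: "y \<in> U" using eU(1) ye by simp
  have "compose U k \<tau> y = (\<lambda>y\<in>V. (y, germ X Y f F y V s)) y"
    using eU y ye by (simp add: compose_eq)
  then obtain W where W: "openin (gtop Y) W" "y \<in> W" "W \<subseteq> U \<inter> V"
    and eq: "\<forall>w\<in>W. compose U k \<tau> w = (\<lambda>y\<in>V. (y, germ X Y f F y V s)) w"
    by (rule sections_agree_nearby[OF is_gsheaf_push[OF F] compose_sections[OF k \<tau> openin_subset[OF U]]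
          germ_sections[OF s] U push_section_openin[OF s] yU y(1)])
  show thesis
  proof
    show "restrict \<tau> W \<in> sections Y E W" using \<tau> W(3) by (intro restrict_sections) auto
    show "push_section F W (restrict s (preim X f W))" using s W by (intro push_section_restrict) auto
    show "\<forall>y\<in>W. k (restrict \<tau> W y) = (y, germ X Y f F y W (restrict s (preim X f W)))"
    proof
      fix w assume w: "w \<in> W"
      then have "w \<in> U" "w \<in> V" using W(3) by auto
      then show "k (restrict \<tau> W w) = (w, germ X Y f F w W (restrict s (preim X f W)))"
        using bspec[OF eq w] w germ_restrict[OF s W(1) _ w] W(3) by (simp add: compose_eq)
    qed
  qed (use W eU ye in auto)
qed

section \<open>Both transposes are morphisms\<close>

lemma adjunct_hom:
  assumes E: "is_gsheaf G Y E" and F: "is_gsheaf G X F" and h: "h \<in> gsheaf_hom G (pull X f E) F"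
  shows "adjunct E F h \<in> gsheaf_hom G E (push G X Y f F)"
proof (rule gsheaf_homI)
  show "continuous_map (gtop E) (gtop (push G X Y f F)) (adjunct E F h)"
  proof (rule continuous_map_if_on_sections[OF E])
    fix e assume e: "e \<in> pts E"
    obtain V \<sigma> where V: "openin (gtop Y) V" and \<sigma>: "\<sigma> \<in> sections Y E V"
      and \<sigma>e: "sproj E e \<in> V" "\<sigma> (sproj E e) = e"
      using gsheaf_section_through[OF E e] by metis
    have "continuous_map (subtopology (gtop Y) V) (gtop (push G X Y f F)) (adjunct E F h \<circ> \<sigma>)"
      by (rule continuous_map_eq[OF sections_continuous[OF germ_sections[OF push_section_pulled[OF h \<sigma> V]]]])
        (simp add: adjunct_eq[OF E h V \<sigma>])
    then show "\<exists>V \<sigma>. openin (gtop Y) V \<and> \<sigma> \<in> sections Y E V \<and> sproj E e \<in> V \<and> \<sigma> (sproj E e) = e \<and>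
        continuous_map (subtopology (gtop Y) V) (gtop (push G X Y f F)) (adjunct E F h \<circ> \<sigma>)"
      using V \<sigma> \<sigma>e by blast
  qed
  fix e assume e: "e \<in> pts E"
  obtain V \<sigma> where V: "openin (gtop Y) V" and \<sigma>: "\<sigma> \<in> sections Y E V"
    and \<sigma>e: "sproj E e \<in> V" "\<sigma> (sproj E e) = e"
    using gsheaf_section_through[OF E e] by metis
  let ?y = "sproj E e"
  note eq = adjunct_eq[OF E h V \<sigma> \<sigma>e(1), unfolded \<sigma>e(2)]
  show "sproj (push G X Y f F) (adjunct E F h e) = sproj E e" using eq by simp
  fix g assume g: "g \<in> carrier G"
  let ?gs = "translate G Y E g V \<sigma>"
  have Vs: "V \<subseteq> pts Y" using V by (rule openin_subset)
  have gV: "openin (gtop Y) (act Y g ` V)" by (rule openin_act_image[OF Y topspace_group g V])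
  have gs: "?gs \<in> sections Y E (act Y g ` V)" by (rule translate_sections[OF Y E topspace_group g \<sigma> Vs])
  have gy: "act Y g ?y \<in> act Y g ` V" using \<sigma>e by blast
  have "?gs (act Y g ?y) = act E g e" using translate_act[OF Y g Vs \<sigma>e(1), of E \<sigma>] \<sigma>e(2) by simp
  with adjunct_eq[OF E h gV gs gy]
  have "adjunct E F h (act E g e) =
      (act Y g ?y, germ X Y f F (act Y g ?y) (act Y g ` V) (pulled_section h (act Y g ` V) ?gs))" by simp
  \<comment> \<open>Equivariance of the transpose reduces to this equality of sections, which is
    equivariance of \<open>h\<close> at the point \<open>(w, \<sigma> (f w))\<close>. The domains
    match by \<open>preim_act\<close>.\<close>
  moreover have "pulled_section h (act Y g ` V) ?gs = translate G X F g (preim X f V) (pulled_section h V \<sigma>)"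
  proof (rule extensionalityI)
    show "translate G X F g (preim X f V) (pulled_section h V \<sigma>) \<in> extensional (preim X f (act Y g ` V))"
      by (simp add: translate_def preim_act[OF g Vs])
    fix x assume x: "x \<in> preim X f (act Y g ` V)"
    then obtain w where w: "w \<in> preim X f V" "x = act X g w"
      using preim_act[OF g Vs] by auto
    then have "(w, \<sigma> (f w)) \<in> pts (pull X f E)"
      using sections_closed[OF \<sigma> Vs] sections_sproj[OF \<sigma>] by (auto simp: pts_pull)
    then have "h (act X g w, act E g (\<sigma> (f w))) = act F g (h (w, \<sigma> (f w)))"
      using gsheaf_hom_act[OF h g] by (force simp: act_pull)
    moreover have "?gs (f x) = act E g (\<sigma> (f w))"
      using translate_act[OF Y g Vs, of "f w" E \<sigma>] f_act[OF g] w by auto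
    moreover have "translate G X F g (preim X f V) (pulled_section h V \<sigma>) x = act F g (pulled_section h V \<sigma> w)"
      unfolding w(2) by (rule translate_act[OF X g _ w(1)]) auto
    ultimately show "pulled_section h (act Y g ` V) ?gs x = translate G X F g (preim X f V) (pulled_section h V \<sigma>) x"
      using x w by (simp add: compose_eq)
  qed simp
  ultimately show "adjunct E F h (act E g e) = act (push G X Y f F) g (adjunct E F h e)"
    using eq act_push_germ[OF F g push_section_pulled[OF h \<sigma> V] \<sigma>e(1)] by simp
qed (simp add: adjunct_def)

lemma coadjunct_eq:
  assumes s: "push_section F V s" and k: "k e = (sproj E e, germ X Y f F (sproj E e) V s)"
    and z: "(x, e) \<in> pts (pull X f E)" and V: "sproj E e \<in> V"
  shows "coadjunct E k (x, e) = s x"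
proof -
  have "x \<in> preim X f V" "sproj E e = f x" using z V by (auto simp: pts_pull)
  then show ?thesis using z k germ_value_germ[OF s] by (simp add: coadjunct_def)
qed

lemma coadjunct_hom:
  assumes E: "is_gsheaf G Y E" and F: "is_gsheaf G X F" and k: "k \<in> gsheaf_hom G E (push G X Y f F)"
  shows "coadjunct E k \<in> gsheaf_hom G (pull X f E) F"
proof (rule gsheaf_homI)
  show "continuous_map (gtop (pull X f E)) (gtop F) (coadjunct E k)"
  proof (rule continuous_map_if_on_sections[OF is_gsheaf_pull[OF E]])
    fix z assume z: "z \<in> pts (pull X f E)"
    then obtain x e where xe: "z = (x, e)" "x \<in> pts X" "e \<in> pts E" "f x = sproj E e"
      by (auto simp: pts_pull)
    obtain W \<sigma> s where W: "openin (gtop Y) W" and \<sigma>: "\<sigma> \<in> sections Y E W"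
      and \<sigma>e: "sproj E e \<in> W" "\<sigma> (sproj E e) = e"
      and s: "push_section F W s" and ks: "\<forall>y\<in>W. k (\<sigma> y) = (y, germ X Y f F y W s)"
      by (rule push_hom_locally[OF E F k xe(3)])
    let ?\<sigma> = "\<lambda>x \<in> preim X f W. (x, \<sigma> (f x))"
    \<comment> \<open>Along the pulled back section through \<open>z\<close> the map is simply
      \<open>s\<close>, which is continuous.\<close>
    have "continuous_map (subtopology (gtop X) (preim X f W)) (gtop F) (coadjunct E k \<circ> ?\<sigma>)"
    proof (rule continuous_map_eq[OF sections_continuous[OF push_section_sections[OF s]]])
      fix w assume "w \<in> topspace (subtopology (gtop X) (preim X f W))"
      then have w: "w \<in> preim X f W" by simp
      have \<sigma>w: "sproj E (\<sigma> (f w)) = f w" "\<sigma> (f w) \<in> pts E"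
        using w sections_sproj[OF \<sigma>] sections_closed[OF \<sigma> openin_subset[OF W]] by auto
      have "coadjunct E k (w, \<sigma> (f w)) = s w"
        by (rule coadjunct_eq[OF s]) (use w \<sigma>w ks in \<open>auto simp: pts_pull\<close>)
      then show "s w = (coadjunct E k \<circ> ?\<sigma>) w" using w by simp
    qed
    then show "\<exists>U \<sigma>. openin (gtop X) U \<and> \<sigma> \<in> sections X (pull X f E) U \<and> sproj (pull X f E) z \<in> U \<and>
        \<sigma> (sproj (pull X f E) z) = z \<and> continuous_map (subtopology (gtop X) U) (gtop F) (coadjunct E k \<circ> \<sigma>)"
      using openin_preim[OF W] pull_section[OF \<sigma> W] xe \<sigma>e
      by (intro exI[of _ "preim X f W"] exI[of _ ?\<sigma>]) auto
  qed
  fix z assume z: "z \<in> pts (pull X f E)"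
  then obtain x e where xe: "z = (x, e)" "x \<in> pts X" "e \<in> pts E" "f x = sproj E e"
    by (auto simp: pts_pull)
  obtain y V s where s: "push_section F V s" and y: "y \<in> V" "k e = (y, germ X Y f F y V s)"
    by (rule push_cases[OF gsheaf_hom_closed[OF k xe(3)]])
  have ye: "sproj E e = y" using gsheaf_hom_sproj[OF k xe(3)] y by simp
  have xV: "x \<in> preim X f V" using xe y ye by simp
  have val: "coadjunct E k z = s x"
    unfolding xe(1) by (rule coadjunct_eq[OF s]) (use y ye z xe in auto)
  show "sproj F (coadjunct E k z) = sproj (pull X f E) z"
    using val sections_sproj[OF push_section_sections[OF s] xV] xe by simp
  fix g assume g: "g \<in> carrier G"
  have gz: "act (pull X f E) g z = (act X g x, act E g e)" using z xe by (simp add: act_pull)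
  \<comment> \<open>By equivariance of \<open>k\<close>, the translate of \<open>s\<close>
    represents the germ at the translated point, so its value there can be used.\<close>
  have "coadjunct E k (act X g x, act E g e) = translate G X F g (preim X f V) s (act X g x)"
  proof (rule coadjunct_eq[OF push_section_translate[OF F g s]])
    show "(act X g x, act E g e) \<in> pts (pull X f E)"
      using gspace_act_closed[OF is_gspace_pull[OF E] g z] gz by simp
    show "sproj E (act E g e) \<in> act Y g ` V"
      using gsheaf_sproj_act[OF E g xe(3)] ye y by simp
    show "k (act E g e) = (sproj E (act E g e),
        germ X Y f F (sproj E (act E g e)) (act Y g ` V) (translate G X F g (preim X f V) s))"
      using gsheaf_hom_act[OF k g xe(3)] y ye gsheaf_sproj_act[OF E g xe(3)] act_push_germ[OF F g s y(1)] by simp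
  qed
  also have "\<dots> = act F g (s x)" by (rule translate_act[OF X g _ xV]) auto
  finally show "coadjunct E k (act (pull X f E) g z) = act F g (coadjunct E k z)"
    using gz val by simp
qed (simp add: coadjunct_def)

section \<open>The bijection and its naturality\<close>

text \<open>The germ assigned to \<open>e\<close> is represented by
  \<open>x \<mapsto> h (x, \<sigma> (f x))\<close>, and over the base point of \<open>e\<close> the
  local section returns \<open>e\<close>.\<close>

lemma coadjunct_adjunct:
  assumes E: "is_gsheaf G Y E" and h: "h \<in> gsheaf_hom G (pull X f E) F"
  shows "coadjunct E (adjunct E F h) = h"
proof (rule extensionalityI)
  fix z assume z: "z \<in> pts (pull X f E)"
  then obtain x e where xe: "z = (x, e)" "x \<in> pts X" "e \<in> pts E" "f x = sproj E e"
    by (auto simp: pts_pull)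
  obtain V \<sigma> where V: "openin (gtop Y) V" and \<sigma>: "\<sigma> \<in> sections Y E V"
    and \<sigma>e: "sproj E e \<in> V" "\<sigma> (sproj E e) = e"
    using gsheaf_section_through[OF E xe(3)] by metis
  have "coadjunct E (adjunct E F h) (x, e) = pulled_section h V \<sigma> x"
    by (rule coadjunct_eq[OF push_section_pulled[OF h \<sigma> V]])
      (use z xe \<sigma>e adjunct_eq[OF E h V \<sigma> \<sigma>e(1)] in auto)
  then show "coadjunct E (adjunct E F h) z = h z" using xe \<sigma>e by (simp add: compose_eq)
qed (use gsheaf_hom_extensional[OF h] in \<open>simp_all add: coadjunct_def\<close>)

text \<open>The transpose is computed from values along a whole local section, so one section
  \<open>s\<close> representing \<open>k\<close> along all of \<open>\<sigma>\<close> is needed. The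
  section induced by \<open>coadjunct E k\<close> and \<open>\<sigma>\<close> is then
  \<open>s\<close> itself.\<close>

lemma adjunct_coadjunct:
  assumes E: "is_gsheaf G Y E" and F: "is_gsheaf G X F" and k: "k \<in> gsheaf_hom G E (push G X Y f F)"
  shows "adjunct E F (coadjunct E k) = k"
proof (rule extensionalityI)
  fix e assume e: "e \<in> pts E"
  obtain W \<sigma> s where W: "openin (gtop Y) W" and \<sigma>: "\<sigma> \<in> sections Y E W"
    and \<sigma>e: "sproj E e \<in> W" "\<sigma> (sproj E e) = e"
    and s: "push_section F W s" and ks: "\<forall>y\<in>W. k (\<sigma> y) = (y, germ X Y f F y W s)"
    by (rule push_hom_locally[OF E F k e])
  note h = coadjunct_hom[OF E F k]
  have "pulled_section (coadjunct E k) W \<sigma> = s"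
  proof (rule extensionalityI)
    show "s \<in> extensional (preim X f W)" by (rule sections_extensional[OF push_section_sections[OF s]])
    fix w assume w: "w \<in> preim X f W"
    have \<sigma>w: "sproj E (\<sigma> (f w)) = f w" "\<sigma> (f w) \<in> pts E"
      using w sections_sproj[OF \<sigma>] sections_closed[OF \<sigma> openin_subset[OF W]] by auto
    have "coadjunct E k (w, \<sigma> (f w)) = s w"
      by (rule coadjunct_eq[OF s]) (use w \<sigma>w ks in \<open>auto simp: pts_pull\<close>)
    then show "pulled_section (coadjunct E k) W \<sigma> w = s w" using w by (simp add: compose_eq)
  qed simp
  then show "adjunct E F (coadjunct E k) e = k e"
    using adjunct_eq[OF E h W \<sigma> \<sigma>e(1)] \<sigma>e bspec[OF ks \<sigma>e(1)] by simp
qed (use gsheaf_hom_extensional[OF k] in \<open>simp_all add: adjunct_def\<close>)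

lemma bij_betw_adjunct:
  assumes E: "is_gsheaf G Y E" and F: "is_gsheaf G X F"
  shows "bij_betw (adjunct E F) (gsheaf_hom G (pull X f E) F) (gsheaf_hom G E (push G X Y f F))"
  by (rule bij_betw_byWitness[where f' = "coadjunct E"])
    (use coadjunct_adjunct[OF E] adjunct_coadjunct[OF E F] adjunct_hom[OF E F] coadjunct_hom[OF E F] in auto)

text \<open>Precomposing \<open>h\<close> with the pull back of \<open>u\<close> amounts to
  replacing the local section \<open>\<sigma>\<close> by its image under \<open>u\<close>, which is
  a local section of \<open>E\<close> through \<open>u e\<close>.\<close>

lemma adjunct_natural_left:
  assumes E: "is_gsheaf G Y E" and E': "is_gsheaf G Y E'" and h: "h \<in> gsheaf_hom G (pull X f E) F"
    and u: "u \<in> gsheaf_hom G E' E"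
  shows "adjunct E' F (compose (pts (pull X f E')) h (pull_map X f E' u)) = compose (pts E') (adjunct E F h) u"
proof (rule extensionalityI)
  note hu = gsheaf_hom_compose[OF is_gspace_pull[OF E'] pull_map_hom[OF E' u] h]
  fix e assume e: "e \<in> pts E'"
  obtain V \<sigma> where V: "openin (gtop Y) V" and \<sigma>: "\<sigma> \<in> sections Y E' V"
    and \<sigma>e: "sproj E' e \<in> V" "\<sigma> (sproj E' e) = e"
    using gsheaf_section_through[OF E' e] by metis
  note u\<sigma> = compose_sections[OF u \<sigma> openin_subset[OF V]]
  have "pulled_section (compose (pts (pull X f E')) h (pull_map X f E' u)) V \<sigma> =
    pulled_section h V (compose V u \<sigma>)"
  proof (rule extensionalityI)
    fix x assume x: "x \<in> preim X f V"
    then have "(x, \<sigma> (f x)) \<in> pts (pull X f E')"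
      using sections_sproj[OF \<sigma>] sections_closed[OF \<sigma> openin_subset[OF V]] by (auto simp: pts_pull)
    then show "pulled_section (compose (pts (pull X f E')) h (pull_map X f E' u)) V \<sigma> x =
        pulled_section h V (compose V u \<sigma>) x"
      using x by (simp add: compose_eq pull_map_def)
  qed simp_all
  then show "adjunct E' F (compose (pts (pull X f E')) h (pull_map X f E' u)) e =
      compose (pts E') (adjunct E F h) u e"
    using adjunct_eq[OF E' hu V \<sigma> \<sigma>e(1)] adjunct_eq[OF E h V u\<sigma> \<sigma>e(1)] \<sigma>e e by (simp add: compose_eq)
qed (simp_all add: adjunct_def)

text \<open>Composition with \<open>v\<close> acts on representatives of germs, and it may be
  carried out before or after substituting the local section.\<close>

lemma adjunct_natural_right:
  assumes E: "is_gsheaf G Y E" and h: "h \<in> gsheaf_hom G (pull X f E) F" and v: "v \<in> gsheaf_hom G F F'"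
  shows "adjunct E F' (compose (pts (pull X f E)) v h) = compose (pts E) (push_map X Y f F F' v) (adjunct E F h)"
proof (rule extensionalityI)
  note vh = gsheaf_hom_compose[OF is_gspace_pull[OF E] h v]
  fix e assume e: "e \<in> pts E"
  obtain V \<sigma> where V: "openin (gtop Y) V" and \<sigma>: "\<sigma> \<in> sections Y E V"
    and \<sigma>e: "sproj E e \<in> V" "\<sigma> (sproj E e) = e"
    using gsheaf_section_through[OF E e] by metis
  have "pulled_section (compose (pts (pull X f E)) v h) V \<sigma> = compose (preim X f V) v (pulled_section h V \<sigma>)"
  proof (rule extensionalityI)
    fix x assume x: "x \<in> preim X f V"
    then have "(x, \<sigma> (f x)) \<in> pts (pull X f E)"
      using sections_sproj[OF \<sigma>] sections_closed[OF \<sigma> openin_subset[OF V]] by (auto simp: pts_pull)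
    then show "pulled_section (compose (pts (pull X f E)) v h) V \<sigma> x =
        compose (preim X f V) v (pulled_section h V \<sigma>) x"
      using x by (simp add: compose_eq)
  qed simp_all
  then show "adjunct E F' (compose (pts (pull X f E)) v h) e =
      compose (pts E) (push_map X Y f F F' v) (adjunct E F h) e"
    using adjunct_eq[OF E vh V \<sigma> \<sigma>e(1)] adjunct_eq[OF E h V \<sigma> \<sigma>e(1)] \<sigma>e e
      push_map_germ[OF v push_section_pulled[OF h \<sigma> V] \<sigma>e(1)] by (simp add: compose_eq)
qed (simp_all add: adjunct_def)

lemma gsheaf_left_adjoint_pull_push:
  "gsheaf_left_adjoint G X Y (pull X f) (\<lambda>E E' u. pull_map X f E u)
     (push G X Y f) (\<lambda>F F' v. push_map X Y f F F' v)"
  unfolding gsheaf_left_adjoint_def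
proof (intro conjI exI[of _ adjunct] allI impI ballI)
qed (simp_all add: gsheaf_functor_pull gsheaf_functor_push bij_betw_adjunct
    adjunct_natural_left adjunct_natural_right)

end

theorem proposition7p3:
  fixes G :: "'g top_group"
    and X :: "('g, 'x) gspace" and Y :: "('g, 'y) gspace"
    and f :: "'x \<Rightarrow> 'y"
  assumes "profinite_group G"
    and "profinite_gspace G X" and "profinite_gspace G Y"
    and "equivariant_map G X Y f"
  shows "gsheaf_left_adjoint G X Y
           (pull X f :: ('g, 'd, 'y) gsheaf \<Rightarrow> ('g, 'x \<times> 'd, 'x) gsheaf)
           (\<lambda>E E' u. pull_map X f E u)
           (push G X Y f :: ('g, 'e, 'x) gsheaf \<Rightarrow> ('g, 'y \<times> ('x, 'y, 'e) germ, 'y) gsheaf)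
           (\<lambda>F F' v. push_map X Y f F F' v)"
proof -
  \<comment> \<open>A continuous map from a compact space to a Hausdorff space is proper.\<close>
  have "proper_map (gtop X) (gtop Y) f"
    using assms by (intro continuous_imp_proper_map)
      (auto simp: profinite_gspace_def profinite_space_def equivariant_map_def Hausdorff_imp_kc_space)
  then interpret proper_equivariant_map G X Y f
    using assms by (simp add: proper_equivariant_map_def profinite_group_def profinite_gspace_def)
  show ?thesis by (rule gsheaf_left_adjoint_pull_push)
qed

end
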